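(* Let $k$ be a real number with $0<k\le 1$ and let $\rho_{AB_1\cdots B_{N-1}}$ be an $N$-qubit mixed state. If $k\,\mathcal{C}_{AB_i}^2\ge \mathcal{C}_{A|B_{i+1}\cdots B_{N-1}}^2$ for all $i=1,2,\ldots,N-2$, then for $\beta\ge 4$, $$ \mathcal{C}^{\beta}_{A|B_1\cdots B_{N-1}} \ \ge\ \sum_{i=1}^{N-2}\Big(\prod_{j=1}^{i}\mathcal{M}_j\Big)\mathcal{C}^{\beta}_{AB_{i+1}}, $$ where $M=\frac{(1+k)^{\beta/2}-1}{k^{\beta/2}}+k^{\beta/2}$ and $\mathcal{M}_j=M-\frac{\mathcal{C}^{\beta}_{A|B_{j+1}\cdots B_{N-1}}}{\mathcal{C}^{\beta}_{AB_j}}$ for $j=1,\ldots,N-2$.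
   Context: An $N$-qubit mixed state is a density matrix (positive semidefinite, trace one) on $H_A\otimes H_{B_1}\otimes\cdots\otimes H_{B_{N-1}}$, where every factor is $\mathbb{C}^2$. For a bipartite pure state $|\psi\rangle_{XY}\in H_X\otimes H_Y$ the concurrence is $\mathcal{C}(|\psi\rangle_{XY})=\sqrt{2(1-\mathrm{tr}\,\rho_X^2)}$ with $\rho_X=\mathrm{tr}_Y|\psi\rangle\langle\psi|$. For a bipartite mixed state $\rho_{XY}$, $\mathcal{C}(\rho_{XY})=\min\sum_i p_i\,\mathcal{C}(|\psi_i\rangle)$, the minimum being over all pure state decompositions $\rho_{XY}=\sum_i p_i|\psi_i\rangle\langle\psi_i|$ with $p_i\ge 0$, $\sum_i p_i=1$. $\mathcal{C}_{AB_i}$ is the concurrence of the two-qubit reduced density matrix $\rho_{AB_i}$ of the given state (partial trace over all other subsystems). $\mathcal{C}_{A|B_{i}\cdots B_{N-1}}$ is the concurrence of the reduced density matrix on $A,B_i,\ldots,B_{N-1}$, viewed as a bipartite state under the bipartition $A$ versus $B_i\cdots B_{N-1}$; in particular $\mathcal{C}_{A|B_{N-1}}=\mathcal{C}_{AB_{N-1}}$. $\mathcal{C}^\beta_{\cdot}$ means $(\mathcal{C}_{\cdot})^\beta$. *)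

theory Defs
  imports "HOL-Analysis.Analysis"
begin

text \<open>
  Matrices are functions with an explicit finite index set, because the index set changes from
  subsystem to subsystem; values outside the index set are irrelevant.

  The qubits carry labels, and the space of the qubits in a finite set \<open>S\<close> (a tensor product of
  copies of the complex plane, one per label) has the computational basis \<open>Pow S\<close>: the
  subset \<open>x\<close> stands for the product vector in which exactly the qubits in \<open>x\<close> are in state 1.
  If \<open>x\<close> and \<open>z\<close> are basis labels of disjoint sets of qubits, \<open>x \<union> z\<close> labels the tensor product.
\<close>

type_synonym 'i cvec = "'i \<Rightarrow> complex"
type_synonym 'i cmat = "'i \<Rightarrow> 'i \<Rightarrow> complex"

definition mtrace :: "'i set \<Rightarrow> 'i cmat \<Rightarrow> complex" where
  "mtrace I A = (\<Sum>x\<in>I. A x x)"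

definition mmult :: "'i set \<Rightarrow> 'i cmat \<Rightarrow> 'i cmat \<Rightarrow> 'i cmat" where
  "mmult I A B = (\<lambda>x y. \<Sum>z\<in>I. A x z * B z y)"

definition pos_semidef :: "'i set \<Rightarrow> 'i cmat \<Rightarrow> bool" where
  "pos_semidef I A \<longleftrightarrow>
     (\<forall>x\<in>I. \<forall>y\<in>I. A y x = cnj (A x y)) \<and>
     (\<forall>v :: 'i cvec. 0 \<le> Re (\<Sum>x\<in>I. \<Sum>y\<in>I. cnj (v x) * A x y * v y))"

definition ketbra :: "'i cvec \<Rightarrow> 'i cmat" where
  "ketbra \<psi> = (\<lambda>x y. \<psi> x * cnj (\<psi> y))"

definition mixed_state :: "'q set \<Rightarrow> 'q set cmat \<Rightarrow> bool" where
  "mixed_state S \<rho> \<longleftrightarrow> pos_semidef (Pow S) \<rho> \<and> mtrace (Pow S) \<rho> = 1"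

definition pure_state :: "'q set \<Rightarrow> 'q set cvec \<Rightarrow> bool" where
  "pure_state S \<psi> \<longleftrightarrow> (\<Sum>x\<in>Pow S. (cmod (\<psi> x))\<^sup>2) = 1"

text \<open>The reduced matrix on the qubits in \<open>T \<subseteq> S\<close>, obtained by tracing out those in \<open>S - T\<close>.\<close>

definition reduced :: "'q set \<Rightarrow> 'q set \<Rightarrow> 'q set cmat \<Rightarrow> 'q set cmat" where
  "reduced S T \<rho> = (\<lambda>x y. \<Sum>z\<in>Pow (S - T). \<rho> (x \<union> z) (y \<union> z))"

text \<open>Concurrence of a pure state of the qubits \<open>S\<close> under the bipartition \<open>X\<close> versus \<open>S - X\<close>.\<close>

definition pure_concurrence :: "'q set \<Rightarrow> 'q set \<Rightarrow> 'q set cvec \<Rightarrow> real" where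
  "pure_concurrence S X \<psi> =
     (let \<rho>X = reduced S X (ketbra \<psi>)
      in sqrt (2 * (1 - Re (mtrace (Pow X) (mmult (Pow X) \<rho>X \<rho>X)))))"

definition pure_decomposition ::
    "'q set \<Rightarrow> 'q set cmat \<Rightarrow> nat \<Rightarrow> (nat \<Rightarrow> real) \<Rightarrow> (nat \<Rightarrow> 'q set cvec) \<Rightarrow> bool" where
  "pure_decomposition S \<rho> n p \<psi> \<longleftrightarrow>
     (\<forall>i<n. 0 \<le> p i \<and> pure_state S (\<psi> i)) \<and> (\<Sum>i<n. p i) = 1 \<and>
     (\<forall>x\<in>Pow S. \<forall>y\<in>Pow S. \<rho> x y = (\<Sum>i<n. of_real (p i) * ketbra (\<psi> i) x y))"

text \<open>
  The convex roof, over decompositions of arbitrary finite length. The minimum is written as an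
  infimum: the set is bounded below by 0, is nonempty for every mixed state by the spectral
  theorem, and by compactness its infimum is attained.
\<close>

definition concurrence :: "'q set \<Rightarrow> 'q set \<Rightarrow> 'q set cmat \<Rightarrow> real" where
  "concurrence S X \<rho> =
     Inf {\<Sum>i<n. p i * pure_concurrence S X (\<psi> i) | n p \<psi>. pure_decomposition S \<rho> n p \<psi>}"

text \<open>
  For an \<open>N\<close>-qubit state the label 0 is the qubit A and the label \<open>i\<close> with \<open>1 \<le> i < N\<close> is the
  qubit B with index \<open>i\<close>. For a set \<open>Y\<close> of B-labels, \<open>conc_A N \<rho> Y\<close> is the concurrence, under the
  bipartition A versus \<open>Y\<close>, of the reduced state on A and \<open>Y\<close>.
\<close>

definition conc_A :: "nat \<Rightarrow> nat set cmat \<Rightarrow> nat set \<Rightarrow> real" where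
  "conc_A N \<rho> Y = concurrence (insert 0 Y) {0} (reduced {..<N} (insert 0 Y) \<rho>)"

definition conc_AB :: "nat \<Rightarrow> nat set cmat \<Rightarrow> nat \<Rightarrow> real" where
  "conc_AB N \<rho> i = conc_A N \<rho> {i}"

definition conc_A_from :: "nat \<Rightarrow> nat set cmat \<Rightarrow> nat \<Rightarrow> real" where
  "conc_A_from N \<rho> i = conc_A N \<rho> {i..<N}"

definition M_const :: "real \<Rightarrow> real \<Rightarrow> real" where
  "M_const k \<beta> = ((1 + k) powr (\<beta> / 2) - 1) / k powr (\<beta> / 2) + k powr (\<beta> / 2)"

text \<open>
  If \<open>conc_AB N \<rho> j = 0\<close>, the quotient is 0 by the convention for division by zero. This is
  harmless where \<open>k * (conc_AB N \<rho> i)\<^sup>2 \<ge> (conc_A_from N \<rho> (i + 1))\<^sup>2\<close> is assumed for all \<open>i\<close>: then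
  \<open>conc_A_from N \<rho> (j + 1) = 0\<close>, hence \<open>conc_AB N \<rho> i = 0\<close> for all \<open>i > j\<close>, and
  \<open>M_coeff k \<beta> N \<rho> j\<close> only occurs multiplied by the power of such a \<open>conc_AB N \<rho> i\<close>.
\<close>

definition M_coeff :: "real \<Rightarrow> real \<Rightarrow> nat \<Rightarrow> nat set cmat \<Rightarrow> nat \<Rightarrow> real" where
  "M_coeff k \<beta> N \<rho> j =
     M_const k \<beta> - conc_A_from N \<rho> (j + 1) powr \<beta> / conc_AB N \<rho> j powr \<beta>"

end

theory Submission
  imports Defs
begin

text \<open>
  The theorem follows from the monogamy inequality
  \<open>C\<^sup>2\<^sub>A\<^sub>|\<^sub>B\<^sub>Y \<ge> C\<^sup>2\<^sub>A\<^sub>B + C\<^sup>2\<^sub>A\<^sub>|\<^sub>Y\<close> and an elementary power inequality. By the triangle inequality in the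
  plane, applied to the members of a decomposition, monogamy reduces to a pure state \<open>\<psi>\<close>.

  Measuring the qubit B in an orthonormal basis splits \<open>\<psi>\<close> into two vectors of A and Y whose
  A-marginals \<open>P\<close>, \<open>Q\<close> satisfy \<open>4 det (P + Q) = C(\<psi>)\<^sup>2\<close>, so \<open>C\<^sup>2\<^sub>A\<^sub>|\<^sub>Y \<le> 8 (det P + det Q)\<close>. As
  \<open>det (P + Q) + det (P - Q) = 2 det P + 2 det Q\<close>, it suffices to choose the basis such that
  \<open>C\<^sup>2\<^sub>A\<^sub>B \<le> - 4 det (P - Q)\<close>, which only involves the two-qubit state of A and B. If that state is
  definite, the Takagi normal form writes it as \<open>\<Sum>\<^sub>c Z\<^sub>c Z\<^sub>c\<^sup>*\<close> with two-by-two matrices \<open>Z\<^sub>c\<close>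
  orthogonal for the polarised determinant, \<open>det Z\<^sub>c = d\<^sub>c > 0\<close>. A suitable basis gives
  \<open>- det (P - Q) \<ge> (\<bar>d\<^sub>1 - d\<^sub>2\<bar> - \<bar>d\<^sub>3 - d\<^sub>4\<bar>)\<^sup>2\<close>, and a Hadamard mixture of the \<open>Z\<^sub>c\<close> with phases has
  average concurrence \<open>2 \<bar>\<bar>d\<^sub>1 - d\<^sub>2\<bar> - \<bar>d\<^sub>3 - d\<^sub>4\<bar>\<bar>\<close>. Singular states follow by compactness.
\<close>

section \<open>Ensembles of a positive semidefinite matrix\<close>

lemma quadform_insert:
  fixes A :: "'i cmat" and v :: "'i cvec"
  assumes "finite I" "a \<notin> I" and herm: "\<forall>x\<in>I. A x a = cnj (A a x)"
  shows "(\<Sum>x\<in>insert a I. \<Sum>y\<in>insert a I. cnj (v x) * A x y * v y) =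
    cnj (v a) * A a a * v a + cnj (v a) * (\<Sum>y\<in>I. A a y * v y) + cnj (\<Sum>y\<in>I. A a y * v y) * v a
    + (\<Sum>x\<in>I. \<Sum>y\<in>I. cnj (v x) * A x y * v y)"
proof -
  have "(\<Sum>x\<in>I. cnj (v x) * A x a * v a) = cnj (\<Sum>y\<in>I. A a y * v y) * v a"
    using herm by (simp add: sum_distrib_left mult_ac)
  then show ?thesis
    using assms(1,2) by (simp add: sum.distrib sum_distrib_left mult.assoc)
qed

text \<open>Cholesky factorisation by induction on the index set: once \<open>a\<close> is split
  off, the matrix left to factorise is \<open>A\<close> itself if the pivot \<open>A a a\<close>
  vanishes and the Schur complement otherwise. This supplies ensembles without
  diagonalising.\<close>

lemma pos_semidef_imp_gram:
  assumes "finite I" and "pos_semidef I A"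
  shows "\<exists>w. \<forall>x\<in>I. \<forall>y\<in>I. A x y = (\<Sum>i\<in>I. w i x * cnj (w i y))"
  using assms
proof (induction I arbitrary: A rule: finite_induct)
  case empty
  then show ?case by simp
next
  case (insert a I)
  define L where "L v = (\<Sum>y\<in>I. A a y * v y)" for v
  define Q where "Q v = (\<Sum>x\<in>I. \<Sum>y\<in>I. cnj (v x) * A x y * v y)" for v
  have herm: "A y x = cnj (A x y)" if "x \<in> insert a I" "y \<in> insert a I" for x y
    using insert.prems that unfolding pos_semidef_def by blast
  have real_a: "A a a = of_real (Re (A a a))"
    using arg_cong [OF herm [of a a], of Im] by (simp add: complex_eq_iff)
  have herm_a: "\<forall>x\<in>I. A x a = cnj (A a x)"
    using herm by blast
  have pos: "0 \<le> Re (cnj s * A a a * s + cnj s * L v + cnj (L v) * s + Q v)" for s v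
  proof -
    define v' where "v' = v(a := s)"
    have "L v' = L v" "Q v' = Q v" "v' a = s"
      unfolding L_def Q_def v'_def using insert.hyps by (auto intro!: sum.cong)
    moreover have "0 \<le> Re (\<Sum>x\<in>insert a I. \<Sum>y\<in>insert a I. cnj (v' x) * A x y * v' y)"
      using insert.prems unfolding pos_semidef_def by blast
    ultimately show ?thesis
      using quadform_insert [OF insert.hyps herm_a, of v'] unfolding L_def Q_def by simp
  qed
  show ?case
  proof (cases "A a a = 0")
    case True
    have zero: "A a x = 0" if "x \<in> I" for x
    proof (rule ccontr)
      assume n0: "A a x \<noteq> 0"
      define v where "v = (\<lambda>y. if y = x then 1 else 0 :: complex)"
      have v: "L v = A a x" "Q v = A x x"
      proof -
        have "L v = (\<Sum>y\<in>I. if y = x then A a y else 0)"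
          unfolding L_def v_def by (intro sum.cong) auto
        then show "L v = A a x" using that insert.hyps by simp
        have "Q v = (\<Sum>z\<in>I. if z = x then (\<Sum>y\<in>I. if y = x then A z y else 0) else 0)"
          unfolding Q_def v_def by (auto intro!: sum.cong)
        then show "Q v = A x x" using that insert.hyps by simp
      qed
      define c where "c = (cmod (A a x))\<^sup>2"
      have c: "c > 0" using n0 by (simp add: c_def)
      \<comment> \<open>With a vanishing pivot the form is affine in \<open>s\<close>; this multiple
        of \<open>A a x\<close> is large enough to outweigh \<open>A x x\<close> and make the form
        negative.\<close>
      define s where "s = of_real (- (\<bar>Re (A x x)\<bar> + 1) / c) * A a x"
      have "cnj s * A a x = of_real (- (\<bar>Re (A x x)\<bar> + 1) / c) * (A a x * cnj (A a x))"
        by (simp add: s_def mult_ac)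
      also have "A a x * cnj (A a x) = of_real c"
        by (simp add: c_def complex_norm_square del: of_real_power)
      finally have s: "cnj s * A a x = of_real (- (\<bar>Re (A x x)\<bar> + 1))"
        using c by (simp flip: of_real_mult)
      have "cnj (A a x) * s = cnj (cnj s * A a x)" by simp
      then have "0 \<le> 2 * (- (\<bar>Re (A x x)\<bar> + 1)) + Re (A x x)"
        using pos [of s v] True unfolding v s by simp
      then show False
        by (simp add: abs_if split: if_splits)
    qed
    have "pos_semidef I A"
      unfolding pos_semidef_def
    proof (intro conjI ballI allI)
      show "A y x = cnj (A x y)" if "x \<in> I" "y \<in> I" for x y
        using herm that by blast
      show "0 \<le> Re (\<Sum>x\<in>I. \<Sum>y\<in>I. cnj (v x) * A x y * v y)" for v
        using pos [of 0 v] by (simp add: Q_def)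
    qed
    from insert.IH [OF this] obtain w
      where w: "\<forall>x\<in>I. \<forall>y\<in>I. A x y = (\<Sum>i\<in>I. w i x * cnj (w i y))" by blast
    define w' where "w' i x = (if i = a \<or> x = a then 0 else w i x)" for i x
    have "A x y = (\<Sum>i\<in>insert a I. w' i x * cnj (w' i y))"
      if "x \<in> insert a I" "y \<in> insert a I" for x y
    proof (cases "x = a \<or> y = a")
      case True
      then have "A x y = 0" using that zero herm_a \<open>A a a = 0\<close> by auto
      then show ?thesis using True by (auto simp: w'_def)
    next
      case False
      then show ?thesis using that w insert.hyps by (auto simp: w'_def intro!: sum.cong)
    qed
    then show ?thesis by blast
  next
    case False
    define \<alpha> where "\<alpha> = Re (A a a)"
    have A\<alpha>: "A a a = of_real \<alpha>" using real_a by (simp add: \<alpha>_def)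
    have "0 \<le> \<alpha>" using pos [of 1 "\<lambda>_. 0"] by (simp add: L_def Q_def \<alpha>_def)
    then have \<alpha>: "0 < \<alpha>" using False A\<alpha> by (cases "\<alpha> = 0") auto
    \<comment> \<open>The Schur complement: its form at \<open>v\<close> is the form of
      \<open>A\<close> at \<open>v\<close> extended by the minimising entry
      \<open>- L v / of_real \<alpha>\<close> at \<open>a\<close>.\<close>
    define B where "B x y = A x y - A x a * A a y / of_real \<alpha>" for x y
    have "pos_semidef I B"
      unfolding pos_semidef_def
    proof (intro conjI ballI allI)
      fix x y assume "x \<in> I" "y \<in> I"
      then have xy: "A y x = cnj (A x y)" "A x a = cnj (A a x)" "A y a = cnj (A a y)"
        using herm by blast+
      show "B y x = cnj (B x y)" unfolding B_def xy(1) by (simp add: xy(2,3))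
    next
      fix v :: "'a \<Rightarrow> complex"
      have AL: "(\<Sum>x\<in>I. cnj (v x) * A x a) = cnj (L v)"
        unfolding L_def using herm_a by (simp add: mult.commute)
      have "(\<Sum>x\<in>I. \<Sum>y\<in>I. cnj (v x) * B x y * v y) =
          Q v - (\<Sum>x\<in>I. cnj (v x) * A x a) * L v / of_real \<alpha>"
        unfolding B_def Q_def L_def
        by (simp add: algebra_simps sum_subtractf sum_distrib_left sum_divide_distrib)
      also have "\<dots> = Q v - cnj (L v) * L v / of_real \<alpha>"
        by (simp only: AL)
      finally have eq: "(\<Sum>x\<in>I. \<Sum>y\<in>I. cnj (v x) * B x y * v y) = Q v - cnj (L v) * L v / of_real \<alpha>" .
      have "cnj s * A a a * s + cnj s * L v + cnj (L v) * s + Q v = Q v - cnj (L v) * L v / of_real \<alpha>"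
        if "s = - L v / of_real \<alpha>" for s
        unfolding A\<alpha> that using \<alpha> by (simp add: field_simps)
      then show "0 \<le> Re (\<Sum>x\<in>I. \<Sum>y\<in>I. cnj (v x) * B x y * v y)"
        unfolding eq using pos [of "- L v / of_real \<alpha>" v] by simp
    qed
    from insert.IH [OF this] obtain w
      where w: "\<forall>x\<in>I. \<forall>y\<in>I. B x y = (\<Sum>i\<in>I. w i x * cnj (w i y))" by blast
    define w' where "w' i x =
      (if i = a then A x a / of_real (sqrt \<alpha>) else if x = a then 0 else w i x)" for i x
    have sq: "complex_of_real (sqrt \<alpha>) * of_real (sqrt \<alpha>) = of_real \<alpha>"
      using \<alpha> by (simp flip: of_real_mult)
    have "A x y = (\<Sum>i\<in>insert a I. w' i x * cnj (w' i y))"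
      if xy: "x \<in> insert a I" "y \<in> insert a I" for x y
    proof -
      have herm_ay: "cnj (A y a) = A a y"
        using herm [OF xy(2), of a] by simp
      have "w' a x * cnj (w' a y) = A x a * A a y / of_real \<alpha>"
        using sq herm_ay by (simp add: w'_def)
      moreover have "(\<Sum>i\<in>I. w' i x * cnj (w' i y)) = A x y - A x a * A a y / of_real \<alpha>"
      proof (cases "x = a \<or> y = a")
        case True
        then have "(\<Sum>i\<in>I. w' i x * cnj (w' i y)) = 0"
          using insert.hyps by (intro sum.neutral) (auto simp: w'_def)
        then show ?thesis using True \<alpha> A\<alpha> by auto
      next
        case False
        then have "(\<Sum>i\<in>I. w' i x * cnj (w' i y)) = B x y"
          using w xy insert.hyps by (auto simp: w'_def intro!: sum.cong)
        then show ?thesis by (simp add: B_def)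
      qed
      ultimately show ?thesis using insert.hyps by simp
    qed
    then show ?thesis by blast
  qed
qed

section \<open>The Takagi normal form of a two-qubit ensemble\<close>

text \<open>A vector of two qubits is read row by row as a two-by-two matrix, the rows belonging to
  the first qubit. Twice the modulus of its determinant is the concurrence.\<close>

definition qdet :: "complex^4 \<Rightarrow> complex" where
  "qdet z = z $ 1 * z $ 4 - z $ 2 * z $ 3"

text \<open>The polarisation of \<open>qdet\<close>: \<open>qpol z z\<close> is twice
  \<open>qdet z\<close>.\<close>

definition qpol :: "complex^4 \<Rightarrow> complex^4 \<Rightarrow> complex" where
  "qpol y z = y $ 1 * z $ 4 + y $ 4 * z $ 1 - y $ 2 * z $ 3 - y $ 3 * z $ 2"

text \<open>The rows of \<open>Z\<close> are the unnormalised members of an ensemble and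
  \<open>gram Z\<close> is its density matrix; ensembles of one state share their
  \<open>gram\<close>.\<close>

definition gram :: "complex^4^'n::finite \<Rightarrow> complex^4^4" where
  "gram Z = (\<chi> i j. \<Sum>c\<in>UNIV. Z $ c $ i * cnj (Z $ c $ j))"

lemma gram_nth: "gram Z $ i $ j = (\<Sum>c\<in>UNIV. Z $ c $ i * cnj (Z $ c $ j))"
  by (simp add: gram_def)

lemma continuous_on_gram: "continuous_on S (gram :: complex^4^'n::finite \<Rightarrow> _)"
  unfolding gram_def by (intro continuous_intros)

lemma continuous_on_qdet [continuous_intros]:
  "continuous_on S f \<Longrightarrow> continuous_on S (\<lambda>x. qdet (f x))"
  unfolding qdet_def by (intro continuous_intros)

lemma norm_gram:
  fixes Z :: "complex^4^'n::finite"
  shows "(norm Z)\<^sup>2 = (\<Sum>i\<in>UNIV. Re (gram Z $ i $ i))"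
proof -
  have "(norm Z)\<^sup>2 = (\<Sum>c\<in>UNIV. \<Sum>i\<in>UNIV. (cmod (Z $ c $ i))\<^sup>2)"
    by (simp add: norm_vec_def L2_set_def sum_nonneg)
  also have "\<dots> = (\<Sum>i\<in>UNIV. \<Sum>c\<in>UNIV. (cmod (Z $ c $ i))\<^sup>2)"
    by (rule sum.swap)
  also have "\<dots> = (\<Sum>i\<in>UNIV. Re (gram Z $ i $ i))"
    unfolding gram_nth by (simp add: cmod_power2 flip: power2_eq_square)
  finally show ?thesis .
qed

text \<open>The trace of \<open>gram Z\<close> is the squared norm of \<open>Z\<close>, which bounds
  the preimage; continuity of \<open>gram\<close> makes it closed.\<close>

lemma compact_gram_vimage:
  fixes K :: "(complex^4^4) set"
  assumes "compact K"
  shows "compact {Z :: complex^4^'n::finite. gram Z \<in> K}"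
proof (rule compact_eq_bounded_closed [THEN iffD2], intro conjI)
  have "closed (gram -` K :: (complex^4^'n) set)"
    using assms continuous_on_gram by (intro closed_vimage compact_imp_closed) (auto)
  then show "closed {Z :: complex^4^'n. gram Z \<in> K}" by (simp add: vimage_def)
  have "bounded ((\<lambda>R. \<Sum>i\<in>UNIV. Re (R $ i $ i)) ` K)"
    using assms by (intro compact_imp_bounded compact_continuous_image continuous_intros)
  then obtain B where B: "\<And>R. R \<in> K \<Longrightarrow> \<bar>\<Sum>i\<in>UNIV. Re (R $ i $ i)\<bar> \<le> B"
    unfolding bounded_iff by auto
  show "bounded {Z :: complex^4^'n. gram Z \<in> K}"
    unfolding bounded_iff
  proof (intro exI ballI)
    fix Z :: "complex^4^'n" assume "Z \<in> {Z. gram Z \<in> K}"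
    then have "(norm Z)\<^sup>2 \<le> B"
      using B [of "gram Z"] by (simp add: norm_gram)
    then show "norm Z \<le> sqrt B" by (simp add: real_le_rsqrt)
  qed
qed

text \<open>For \<open>w\<close> of modulus one this is a unitary rotation of the members
  \<open>p\<close> and \<open>q\<close> by the angle \<open>t\<close>, so it preserves the density
  matrix.\<close>

definition mix :: "complex^4^'n::finite \<Rightarrow> 'n \<Rightarrow> 'n \<Rightarrow> complex \<Rightarrow> real \<Rightarrow> complex^4^'n" where
  "mix Z p q w t = (\<chi> c. if c = p then of_real (cos t) *s Z $ p + (w * of_real (sin t)) *s Z $ q
     else if c = q then of_real (cos t) *s Z $ q - (cnj w * of_real (sin t)) *s Z $ p else Z $ c)"

lemma sum_two:
  fixes f :: "'n::finite \<Rightarrow> 'a::comm_monoid_add"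
  assumes "p \<noteq> q"
  shows "(\<Sum>c\<in>UNIV. f c) = f p + (f q + (\<Sum>c\<in>UNIV - {p} - {q}. f c))"
  using assms by (simp add: sum.remove [of UNIV p] sum.remove [of "UNIV - {p}" q])

lemma sin_cos_cis: "complex_of_real (cos t) * of_real (cos t) + of_real (sin t) * of_real (sin t) = 1"
  by (metis of_real_1 of_real_add of_real_mult power2_eq_square sin_cos_squared_add2)

lemma gram_mix:
  fixes Z :: "complex^4^'n::finite"
  assumes "p \<noteq> q" and w: "w * cnj w = 1"
  shows "gram (mix Z p q w t) = gram Z"
proof -
  define C S where "C = complex_of_real (cos t)" and "S = complex_of_real (sin t)"
  have CS: "C * C + S * S = 1" unfolding C_def S_def by (rule sin_cos_cis)
  have "gram (mix Z p q w t) $ i $ j = gram Z $ i $ j" for i j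
  proof -
    define a b x y where "a = Z $ p $ i" "b = Z $ q $ i" "x = cnj (Z $ p $ j)" "y = cnj (Z $ q $ j)"
    have "(C * a + w * S * b) * (C * x + cnj w * S * y) + (C * b - cnj w * S * a) * (C * y - w * S * x)
      = (C * C + (w * cnj w) * (S * S)) * (a * x + b * y)" by (simp add: algebra_simps)
    then have *: "(C * a + w * S * b) * (C * x + cnj w * S * y) + (C * b - cnj w * S * a) * (C * y - w * S * x)
      = a * x + b * y" using w CS by simp
    have "(\<Sum>c\<in>UNIV - {p} - {q}. mix Z p q w t $ c $ i * cnj (mix Z p q w t $ c $ j)) =
      (\<Sum>c\<in>UNIV - {p} - {q}. Z $ c $ i * cnj (Z $ c $ j))"
      by (intro sum.cong) (auto simp: mix_def)
    moreover have "mix Z p q w t $ p $ i = C * a + w * S * b" "mix Z p q w t $ q $ i = C * b - cnj w * S * a"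
      "cnj (mix Z p q w t $ p $ j) = C * x + cnj w * S * y" "cnj (mix Z p q w t $ q $ j) = C * y - w * S * x"
      using assms(1) by (simp_all add: mix_def a_b_x_y_def C_def S_def)
    ultimately show ?thesis
      unfolding gram_nth sum_two [OF assms(1)] using *
      by (simp add: a_b_x_y_def add.assoc [symmetric])
  qed
  then show ?thesis by (simp add: vec_eq_iff)
qed

lemma qdet_add: "qdet (a *s y + b *s z) = a\<^sup>2 * qdet y + a * b * qpol y z + b\<^sup>2 * qdet z"
  by (simp add: qdet_def qpol_def power2_eq_square algebra_simps)

lemma qdet_diff: "qdet (a *s y - b *s z) = a\<^sup>2 * qdet y - a * b * qpol y z + b\<^sup>2 * qdet z"
  by (simp add: qdet_def qpol_def power2_eq_square algebra_simps)

lemma qpol_commute: "qpol y z = qpol z y"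
  by (simp add: qpol_def algebra_simps)

text \<open>At \<open>t = 0\<close> the left-hand side equals its bound \<open>A\<close>, so it has
  a maximum there, and its derivative at 0 is \<open>B\<close>.\<close>

lemma mixed_trig_bound_imp_zero:
  fixes A B C :: real
  assumes "\<And>t. A * (cos t)\<^sup>2 + B * (sin t * cos t) + C * (sin t)\<^sup>2 \<le> A"
  shows "B = 0"
proof -
  let ?f = "\<lambda>t. A * (cos t)\<^sup>2 + B * (sin t * cos t) + C * (sin t)\<^sup>2"
  have "(?f has_real_derivative B) (at 0)"
    by (auto intro!: derivative_eq_intros)
  moreover have "\<forall>y. \<bar>0 - y\<bar> < 1 \<longrightarrow> ?f y \<le> ?f 0"
    using assms by simp
  ultimately show ?thesis
    using DERIV_local_max [of ?f B 0 1] by simp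
qed

text \<open>
  The Takagi normal form: a maximiser of the weighted sum of the real parts of the
  determinants diagonalises the quadratic form, since for distinct positive weights no
  infinitesimal unitary mixing of two members may increase the sum.
\<close>

lemma takagi_ensemble:
  fixes Z0 :: "complex^4^'n::finite"
  obtains Z :: "complex^4^'n" where "gram Z = gram Z0"
    and "\<And>c. qdet (Z $ c) \<in> \<real> \<and> 0 \<le> Re (qdet (Z $ c))"
    and "\<And>c d. c \<noteq> d \<Longrightarrow> qpol (Z $ c) (Z $ d) = 0"
proof -
  obtain e :: "'n \<Rightarrow> nat" where e: "inj e"
    using finite_imp_inj_to_nat_seg [OF finite_class.finite_UNIV] by blast
  define a where "a c = real (Suc (e c))" for c
  have apos: "0 < a c" for c by (simp add: a_def)
  have adist: "a c \<noteq> a d" if "c \<noteq> d" for c d using that e by (auto simp: a_def inj_def)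
  define f where "f Z = (\<Sum>c\<in>UNIV. a c * Re (qdet (Z $ c)))" for Z :: "complex^4^'n"
  have "compact {Z :: complex^4^'n. gram Z \<in> {gram Z0}}"
    by (rule compact_gram_vimage) simp
  moreover have "{Z :: complex^4^'n. gram Z \<in> {gram Z0}} \<noteq> {}" by blast
  moreover have "continuous_on {Z :: complex^4^'n. gram Z \<in> {gram Z0}} f"
    unfolding f_def by (intro continuous_intros)
  ultimately obtain Z where Z: "gram Z = gram Z0" and max: "\<And>Y. gram Y = gram Z0 \<Longrightarrow> f Y \<le> f Z"
    using continuous_attains_sup [of "{Z :: complex^4^'n. gram Z \<in> {gram Z0}}" f] by auto
  show ?thesis
  proof
    show "gram Z = gram Z0" by fact
    show "qdet (Z $ c) \<in> \<real> \<and> 0 \<le> Re (qdet (Z $ c))" for c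
    proof -
      define D where "D = qdet (Z $ c)"
      \<comment> \<open>A phase on a single member can turn its determinant into its modulus; a
        maximiser gains nothing from this.\<close>
      obtain w where w: "cmod w = 1" "w\<^sup>2 * D = of_real (cmod D)"
      proof (cases "D = 0")
        case True
        then show ?thesis using that [of 1] by simp
      next
        case False
        define u where "u = csqrt (of_real (cmod D) / D)"
        have "u\<^sup>2 = of_real (cmod D) / D" by (simp add: u_def)
        moreover have "cmod u = 1" using False by (simp add: u_def norm_csqrt norm_divide)
        ultimately show ?thesis using that [of u] False by simp
      qed
      define Y where "Y = (\<chi> d. if d = c then w *s Z $ c else Z $ d)"
      have "w * cnj w = 1" using w(1) by (simp add: complex_norm_square [symmetric])
      then have "w * z * (cnj w * y) = z * y" for z y
        by (metis mult.assoc mult.left_commute mult.left_neutral)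
      then have "gram Y = gram Z"
        by (auto simp: vec_eq_iff gram_nth Y_def intro!: sum.cong)
      then have "f Y \<le> f Z" using max Z by simp
      moreover have "qdet (w *s Z $ c) = of_real (cmod D)"
        using w(2) by (simp add: qdet_def D_def power2_eq_square algebra_simps)
      then have "f Y - f Z = a c * (cmod D - Re D)"
        unfolding f_def by (simp add: sum.remove [of UNIV c] Y_def D_def algebra_simps)
      ultimately have "a c * (cmod D - Re D) \<le> 0" by linarith
      then have "cmod D \<le> Re D" using apos [of c] by (simp add: mult_le_0_iff)
      then have "Re D = cmod D" using complex_Re_le_cmod [of D] by linarith
      then have "Im D = 0" "0 \<le> Re D"
        using cmod_power2 [of D] by simp_all
      then show ?thesis unfolding D_def [symmetric] by (simp add: complex_is_Real_iff)
    qed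
    show "qpol (Z $ p) (Z $ q) = 0" if "p \<noteq> q" for p q
    proof -
      define X P Q where "X = qpol (Z $ p) (Z $ q)" "P = qdet (Z $ p)" "Q = qdet (Z $ q)"
      have key: "a p * Re (w * X) - a q * Re (cnj w * X) = 0" if w: "w * cnj w = 1" for w
      proof (rule mixed_trig_bound_imp_zero)
        fix t :: real
        define C S where "C = cos t" and "S = sin t"
        have "f (mix Z p q w t) \<le> f Z"
          using max gram_mix [OF \<open>p \<noteq> q\<close> w] Z by simp
        moreover have "(\<Sum>c\<in>UNIV - {p} - {q}. a c * Re (qdet (mix Z p q w t $ c))) =
            (\<Sum>c\<in>UNIV - {p} - {q}. a c * Re (qdet (Z $ c)))"
          by (intro sum.cong) (auto simp: mix_def)
        moreover have "qdet (mix Z p q w t $ p) = C\<^sup>2 * P + C * (w * S) * X + (w * S)\<^sup>2 * Q"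
          "qdet (mix Z p q w t $ q) = C\<^sup>2 * Q - C * (cnj w * S) * X + (cnj w * S)\<^sup>2 * P"
          using \<open>p \<noteq> q\<close> by (auto simp: mix_def qdet_add qdet_diff X_P_Q_def C_def S_def qpol_commute [of "Z $ q"])
        ultimately have "a p * Re (C\<^sup>2 * P + C * (w * S) * X + (w * S)\<^sup>2 * Q)
           + a q * Re (C\<^sup>2 * Q - C * (cnj w * S) * X + (cnj w * S)\<^sup>2 * P) \<le> a p * Re P + a q * Re Q"
          unfolding f_def sum_two [OF \<open>p \<noteq> q\<close>] by (simp add: X_P_Q_def)
        moreover have "a p * Re (C\<^sup>2 * P + C * (w * S) * X + (w * S)\<^sup>2 * Q)
           + a q * Re (C\<^sup>2 * Q - C * (cnj w * S) * X + (cnj w * S)\<^sup>2 * P) =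
           (a p * Re P + a q * Re Q) * C\<^sup>2 + (a p * Re (w * X) - a q * Re (cnj w * X)) * (S * C)
           + (a p * Re (w\<^sup>2 * Q) + a q * Re ((cnj w)\<^sup>2 * P)) * S\<^sup>2"
          by (simp add: power2_eq_square algebra_simps)
        ultimately show "(a p * Re P + a q * Re Q) * (cos t)\<^sup>2
          + (a p * Re (w * X) - a q * Re (cnj w * X)) * (sin t * cos t)
          + (a p * Re (w\<^sup>2 * Q) + a q * Re ((cnj w)\<^sup>2 * P)) * (sin t)\<^sup>2 \<le> a p * Re P + a q * Re Q"
          by (simp add: C_def S_def)
      qed
      \<comment> \<open>The phase 1 isolates the real part of \<open>X\<close>, with a factor that
        is nonzero as the weights differ; the phase \<open>\<i>\<close> isolates the imaginary part,
        with a positive factor.\<close>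
      have "(a p - a q) * Re X = 0" using key [of 1] by (simp add: algebra_simps)
      moreover have "(a p + a q) * Im X = 0" using key [of \<i>] by (simp add: algebra_simps)
      ultimately have "X = 0"
        using adist [OF \<open>p \<noteq> q\<close>] apos [of p] apos [of q] by (simp add: complex_eq_iff)
      then show ?thesis by (simp add: X_P_Q_def)
    qed
  qed
qed

section \<open>Product vectors and traceless Hermitian forms\<close>

definition tens :: "complex^2 \<Rightarrow> complex^2 \<Rightarrow> complex^4" where
  "tens w v = vector [w $ 1 * v $ 1, w $ 1 * v $ 2, w $ 2 * v $ 1, w $ 2 * v $ 2]"

definition det2 :: "complex^2 \<Rightarrow> complex^2 \<Rightarrow> complex" where
  "det2 v w = v $ 1 * w $ 2 - v $ 2 * w $ 1"

lemma vector_4 [simp]: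
  "(vector [a, b, c, d] :: 'a::zero^4) $ 1 = a" "(vector [a, b, c, d] :: 'a^4) $ 2 = b"
  "(vector [a, b, c, d] :: 'a^4) $ 3 = c" "(vector [a, b, c, d] :: 'a^4) $ 4 = d"
  by (simp_all add: vector_def)

lemma tens_nth [simp]:
  "tens w v $ 1 = w $ 1 * v $ 1" "tens w v $ 2 = w $ 1 * v $ 2"
  "tens w v $ 3 = w $ 2 * v $ 1" "tens w v $ 4 = w $ 2 * v $ 2"
  by (simp_all add: tens_def)

text \<open>A two-by-two matrix with determinant zero has rank at most one.\<close>

lemma qdet_eq_0_imp_tens:
  assumes "qdet z = 0"
  obtains w v where "z = tens w v"
proof -
  have q: "z $ 1 * z $ 4 = z $ 2 * z $ 3" using assms by (simp add: qdet_def)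
  consider "z $ 1 \<noteq> 0" | "z $ 1 = 0" "z $ 2 \<noteq> 0" | "z $ 1 = 0" "z $ 2 = 0" by blast
  then show ?thesis
  proof cases
    case 1
    with q have "z = tens (vector [1, z $ 3 / z $ 1]) (vector [z $ 1, z $ 2])"
      by (simp add: vec_eq_iff forall_4 field_simps)
    then show ?thesis by (rule that)
  next
    case 2
    with q have "z = tens (vector [1, z $ 4 / z $ 2]) (vector [z $ 1, z $ 2])"
      by (simp add: vec_eq_iff forall_4 field_simps)
    then show ?thesis by (rule that)
  next
    case 3
    then have "z = tens (vector [0, 1]) (vector [z $ 3, z $ 4])"
      by (simp add: vec_eq_iff forall_4)
    then show ?thesis by (rule that)
  qed
qed

lemma qpol_tens: "qpol (tens w v) (tens w' v') = det2 w w' * det2 v v'"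
  by (simp add: qpol_def det2_def algebra_simps)

lemma det2_eq_0_imp_smult:
  assumes "det2 v w = 0" "v \<noteq> 0"
  obtains c where "w = c *s v"
proof (cases "v $ 1 = 0")
  case True
  then have "w = (w $ 2 / v $ 2) *s v"
    using assms by (auto simp: det2_def vec_eq_iff forall_2)
  then show ?thesis by (rule that)
next
  case False
  then have "w = (w $ 1 / v $ 1) *s v"
    using assms(1) by (auto simp: det2_def vec_eq_iff forall_2 field_simps)
  then show ?thesis by (rule that)
qed

lemma det2_neq_0_imp_neq_0: "det2 v w \<noteq> 0 \<Longrightarrow> v \<noteq> 0 \<and> w \<noteq> 0"
  by (auto simp: det2_def)

lemma det2_commute: "det2 v w = - det2 w v"
  by (simp add: det2_def)

lemma tens_smult: "tens (a *s w) (b *s v) = (a * b) *s tens w v"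
  by (simp add: vec_eq_iff forall_4 algebra_simps)

lemma qpol_smult: "qpol (a *s y) (b *s z) = a * b * qpol y z"
  by (simp add: qpol_def algebra_simps)

text \<open>
  In an orthonormal basis of the quadratic form \<open>qdet\<close> the combinations
  \<open>\<Psi>\<^sub>1 \<plusminus> \<i> \<Psi>\<^sub>2\<close> and \<open>\<Psi>\<^sub>3 \<plusminus> \<i> \<Psi>\<^sub>4\<close> are isotropic, that is, product vectors.
\<close>

lemma null_tetrad:
  assumes null: "qdet E = 0" "qdet F = 0" "qdet G = 0" "qdet H = 0"
    and EF: "qpol E F = 1" and GH: "qpol G H = 1"
    and orth: "qpol E G = 0" "qpol E H = 0" "qpol F G = 0" "qpol F H = 0"
  obtains w1 w2 v1 v2 \<kappa> \<kappa>' where "E = tens w1 v1" "F = tens w2 v2"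
    "G = \<kappa> *s tens w1 v2 \<and> H = \<kappa>' *s tens w2 v1 \<or> H = \<kappa> *s tens w1 v2 \<and> G = \<kappa>' *s tens w2 v1"
    "det2 w1 w2 * det2 v1 v2 = 1" "\<kappa> * \<kappa>' = -1"
proof -
  obtain w1 v1 where E: "E = tens w1 v1" using qdet_eq_0_imp_tens null(1) .
  obtain w2 v2 where F: "F = tens w2 v2" using qdet_eq_0_imp_tens null(2) .
  have det: "det2 w1 w2 * det2 v1 v2 = 1" using EF by (simp add: E F qpol_tens)
  then have det': "det2 w1 w2 \<noteq> 0" "det2 v1 v2 \<noteq> 0" by auto
  then have n0: "w1 \<noteq> 0" "w2 \<noteq> 0" "v1 \<noteq> 0" "v2 \<noteq> 0"
    using det2_neq_0_imp_neq_0 [OF det'(1)] det2_neq_0_imp_neq_0 [OF det'(2)] by simp_all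
  \<comment> \<open>An isotropic vector orthogonal to \<open>E\<close> and \<open>F\<close> shares a
    factor with each of them. If both shared factors lie on the same side, that factor is parallel
    to two independent vectors, so \<open>T\<close> vanishes.\<close>
  have *: "(\<exists>c. T = c *s tens w1 v2) \<or> (\<exists>c. T = c *s tens w2 v1)"
    if T: "qdet T = 0" "qpol E T = 0" "qpol F T = 0" for T
  proof -
    obtain w v where wv: "T = tens w v" using qdet_eq_0_imp_tens T(1) .
    have or: "det2 w1 w = 0 \<or> det2 v1 v = 0" "det2 w2 w = 0 \<or> det2 v2 v = 0"
      using T(2,3) by (auto simp: wv E F qpol_tens)
    have sub: "T = 0" if dd: "det2 u w = 0" "det2 u' w = 0" "det2 u u' \<noteq> 0" for u u'
    proof -
      obtain c where c: "w = c *s u"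
        using det2_eq_0_imp_smult [OF dd(1)] det2_neq_0_imp_neq_0 [OF dd(3)] by blast
      have "det2 u' (c *s u) = - (c * det2 u u')" by (simp add: det2_def algebra_simps)
      then have "c = 0" using dd(2,3) c by simp
      then show ?thesis using c wv by (simp add: vec_eq_iff forall_4)
    qed
    have sub': "T = 0" if dd: "det2 u v = 0" "det2 u' v = 0" "det2 u u' \<noteq> 0" for u u'
    proof -
      obtain c where c: "v = c *s u"
        using det2_eq_0_imp_smult [OF dd(1)] det2_neq_0_imp_neq_0 [OF dd(3)] by blast
      have "det2 u' (c *s u) = - (c * det2 u u')" by (simp add: det2_def algebra_simps)
      then have "c = 0" using dd(2,3) c by simp
      then show ?thesis using c wv by (simp add: vec_eq_iff forall_4)
    qed
    have zero: "\<exists>c. T = c *s tens w1 v2" if "T = 0"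
      using that by (intro exI [of _ 0]) (simp add: vec_eq_iff)
    consider "det2 w1 w = 0" "det2 w2 w = 0" | "det2 v1 v = 0" "det2 v2 v = 0"
      | "det2 w1 w = 0" "det2 v2 v = 0" | "det2 v1 v = 0" "det2 w2 w = 0"
      using or by blast
    then show ?thesis
    proof cases
      case 1
      then show ?thesis using sub det' zero by blast
    next
      case 2
      then show ?thesis using sub' det' zero by blast
    next
      case 3
      obtain c where c: "w = c *s w1" using det2_eq_0_imp_smult [OF 3(1) n0(1)] .
      obtain d where d: "v = d *s v2" using det2_eq_0_imp_smult [OF 3(2) n0(4)] .
      show ?thesis unfolding wv c d tens_smult by blast
    next
      case 4
      obtain c where c: "w = c *s w2" using det2_eq_0_imp_smult [OF 4(2) n0(2)] .
      obtain d where d: "v = d *s v1" using det2_eq_0_imp_smult [OF 4(1) n0(3)] .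
      show ?thesis unfolding wv c d tens_smult by blast
    qed
  qed
  have same: "qpol (c *s tens w v) (d *s tens w v') = 0" "qpol (c *s tens v w) (d *s tens v' w) = 0" for c d w v v'
    by (simp_all add: qpol_smult qpol_tens) (simp_all add: det2_def)
  have prod: "\<kappa> * \<kappa>' = -1" if "qpol (\<kappa> *s tens w1 v2) (\<kappa>' *s tens w2 v1) = 1" for \<kappa> \<kappa>'
  proof -
    have "\<kappa> * \<kappa>' * (det2 w1 w2 * det2 v2 v1) = 1" using that by (simp add: qpol_smult qpol_tens)
    moreover have "det2 w1 w2 * det2 v2 v1 = -1" using det by (simp add: det2_commute [of v2])
    ultimately have "- (\<kappa> * \<kappa>') = 1" by simp
    then show ?thesis by (metis minus_minus)
  qed
  \<comment> \<open>Multiples of one product vector are orthogonal under \<open>qpol\<close>,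
    whereas \<open>qpol G H\<close> is 1, so \<open>G\<close> and \<open>H\<close> lie on different
    lines.\<close>
  have "\<not> ((\<exists>c. G = c *s tens w1 v2) \<and> (\<exists>d. H = d *s tens w1 v2))"
    "\<not> ((\<exists>c. G = c *s tens w2 v1) \<and> (\<exists>d. H = d *s tens w2 v1))"
    using GH same by auto
  with * [OF null(3) orth(1,3)] * [OF null(4) orth(2,4)]
  consider (a) c d where "G = c *s tens w1 v2" "H = d *s tens w2 v1"
    | (b) c d where "H = c *s tens w1 v2" "G = d *s tens w2 v1"
    by blast
  then show ?thesis
  proof cases
    case a
    moreover have "c * d = -1" using GH by (intro prod) (simp add: a)
    ultimately show ?thesis using that [OF E F _ det, of c d] by blast
  next
    case b
    moreover have "c * d = -1" using GH by (intro prod) (simp add: b qpol_commute)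
    ultimately show ?thesis using that [OF E F _ det, of c d] by blast
  qed
qed

text \<open>
  \<open>hform x y\<close> is the sesquilinear form of the traceless Hermitian matrix with first row \<open>x, y\<close>.
  For the density matrix \<open>R\<close> of two qubits, \<open>hmat\<close> traces out the second qubit of \<open>R\<close>
  times this matrix, and \<open>hdet\<close> is minus the determinant of the result.
\<close>

definition hform :: "real \<Rightarrow> complex \<Rightarrow> complex \<Rightarrow> complex \<Rightarrow> complex \<Rightarrow> complex \<Rightarrow> complex" where
  "hform x y r1 r2 s1 s2 = of_real x * r1 * cnj s1 + y * r1 * cnj s2 + cnj y * r2 * cnj s1 - of_real x * r2 * cnj s2"

definition hmat :: "complex^4^4 \<Rightarrow> real \<Rightarrow> complex \<Rightarrow> 4 \<Rightarrow> 4 \<Rightarrow> 4 \<Rightarrow> 4 \<Rightarrow> complex" where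
  "hmat R x y i i' j j' = of_real x * R $ i $ j + y * R $ i $ j' + cnj y * R $ i' $ j - of_real x * R $ i' $ j'"

definition hdet :: "complex^4^4 \<Rightarrow> real \<Rightarrow> complex \<Rightarrow> real" where
  "hdet R x y = (cmod (hmat R x y 1 2 3 4))\<^sup>2 - Re (hmat R x y 1 2 1 2) * Re (hmat R x y 3 4 3 4)"

lemma hmat_gram:
  "hmat (gram Z) x y i i' j j' = (\<Sum>c\<in>UNIV. hform x y (Z $ c $ i) (Z $ c $ i') (Z $ c $ j) (Z $ c $ j'))"
  unfolding hmat_def hform_def gram_nth
  by (simp add: sum.distrib sum_subtractf sum_distrib_left mult.assoc)

lemma hform_smult: "hform x y (a * r1) (a * r2) (b * s1) (b * s2) = a * cnj b * hform x y r1 r2 s1 s2"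
  by (simp add: hform_def algebra_simps)

section \<open>Isotropic vectors of a traceless Hermitian form\<close>

lemma hform_comb:
  assumes "hform x y p1 p2 p1 p2 = 0" "hform x y q1 q2 q1 q2 = 0"
  shows "hform x y (a * p1 + b * q1) (a * p2 + b * q2) (c * p1 + d * q1) (c * p2 + d * q2) =
    a * cnj d * hform x y p1 p2 q1 q2 + b * cnj c * cnj (hform x y p1 p2 q1 q2)"
proof -
  have "hform x y (a * p1 + b * q1) (a * p2 + b * q2) (c * p1 + d * q1) (c * p2 + d * q2) =
    a * cnj c * hform x y p1 p2 p1 p2 + b * cnj d * hform x y q1 q2 q1 q2
    + a * cnj d * hform x y p1 p2 q1 q2 + b * cnj c * cnj (hform x y p1 p2 q1 q2)"
    by (simp add: hform_def algebra_simps)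
  then show ?thesis using assms by simp
qed

text \<open>The traceless matrix has determinant -1, so the matrix of form values on
  \<open>p\<close> and \<open>q\<close> has as determinant minus the squared modulus of the
  determinant of the pair. By isotropy only its off-diagonal entries survive.\<close>

lemma cmod_hform_isotropic:
  assumes "hform x y p1 p2 p1 p2 = 0" "hform x y q1 q2 q1 q2 = 0" "x\<^sup>2 + (cmod y)\<^sup>2 = 1"
  shows "cmod (hform x y p1 p2 q1 q2) = cmod (p1 * q2 - p2 * q1)"
proof -
  have "hform x y p1 p2 q1 q2 * cnj (hform x y p1 p2 q1 q2) - hform x y p1 p2 p1 p2 * hform x y q1 q2 q1 q2
    = (of_real x * of_real x + y * cnj y) * ((p1 * q2 - p2 * q1) * cnj (p1 * q2 - p2 * q1))"
    by (simp add: hform_def algebra_simps)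
  moreover have "of_real x * of_real x + y * cnj y = (1 :: complex)"
    using assms(3) by (metis complex_norm_square of_real_1 of_real_add of_real_power power2_eq_square)
  ultimately have "of_real ((cmod (hform x y p1 p2 q1 q2))\<^sup>2) = complex_of_real ((cmod (p1 * q2 - p2 * q1))\<^sup>2)"
    using assms(1) by (simp add: complex_norm_square del: of_real_power)
  then have "(cmod (hform x y p1 p2 q1 q2))\<^sup>2 = (cmod (p1 * q2 - p2 * q1))\<^sup>2"
    using of_real_eq_iff by blast
  then show ?thesis by (simp add: power2_eq_iff_nonneg)
qed

text \<open>The form value at a vector is the inner product of the point with coordinates
  \<open>x\<close>, \<open>Re y\<close>, \<open>Im y\<close> and the Bloch vector \<open>b\<close>.
  In three dimensions some unit vector is orthogonal to two given Bloch vectors.\<close>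

lemma exists_isotropic_pair:
  obtains x y where "x\<^sup>2 + (cmod y)\<^sup>2 = 1" "hform x y p1 p2 p1 p2 = 0" "hform x y q1 q2 q1 q2 = 0"
proof -
  define b :: "complex \<Rightarrow> complex \<Rightarrow> real^3"
    where "b r s = vector [(cmod r)\<^sup>2 - (cmod s)\<^sup>2, 2 * Re (r * cnj s), - 2 * Im (r * cnj s)]" for r s
  have "dim {b p1 p2, b q1 q2} \<le> card {b p1 p2, b q1 q2}"
    by (intro dim_le_card') simp
  also have "\<dots> \<le> 2" by (simp add: card_insert_if)
  finally have "dim {b p1 p2, b q1 q2} < DIM(real^3)" by simp
  then obtain n0 where n0: "n0 \<noteq> 0" "\<And>y. y \<in> span {b p1 p2, b q1 q2} \<Longrightarrow> orthogonal n0 y"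
    by (rule orthogonal_to_subspace_exists) blast
  define n where "n = n0 /\<^sub>R norm n0"
  have n: "norm n = 1" "n \<bullet> b p1 p2 = 0" "n \<bullet> b q1 q2 = 0"
    using n0 by (auto simp: n_def orthogonal_def span_base)
  define x y where "x = n $ 1" "y = Complex (n $ 2) (n $ 3)"
  have h: "hform x y r s r s = of_real (n \<bullet> b r s)" for r s
    by (simp add: hform_def complex_eq_iff x_y_def b_def inner_vec_def sum_3 cmod_power2)
      (simp add: power2_eq_square algebra_simps)
  have "(norm n)\<^sup>2 = (n $ 1)\<^sup>2 + (n $ 2)\<^sup>2 + (n $ 3)\<^sup>2"
    unfolding norm_vec_def L2_set_def by (simp add: sum_3)
  then have "x\<^sup>2 + (cmod y)\<^sup>2 = 1" using n(1) by (simp add: x_y_def cmod_power2)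
  then show ?thesis using that n h by simp
qed

text \<open>The matrix is congruent to the off-diagonal one with entries \<open>C\<close> and
  \<open>cnj C\<close>, by the matrix with columns \<open>(a, a')\<close> and
  \<open>(b, b')\<close>.\<close>

lemma hdet_offdiagonal:
  assumes H: "hmat R x y 1 2 1 2 = C * a * cnj b + cnj C * b * cnj a"
    "hmat R x y 1 2 3 4 = C * a * cnj b' + cnj C * b * cnj a'"
    "hmat R x y 3 4 3 4 = C * a' * cnj b' + cnj C * b' * cnj a'"
  shows "hdet R x y = (cmod C)\<^sup>2 * (cmod (a * b' - a' * b))\<^sup>2"
proof -
  have re: "of_real (Re (C * a * cnj b + cnj C * b * cnj a)) = C * a * cnj b + cnj C * b * cnj a" for a b
    by (simp add: complex_eq_iff algebra_simps)
  have "complex_of_real (hdet R x y) =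
    (C * a * cnj b' + cnj C * b * cnj a') * cnj (C * a * cnj b' + cnj C * b * cnj a')
    - (C * a * cnj b + cnj C * b * cnj a) * (C * a' * cnj b' + cnj C * b' * cnj a')"
    unfolding hdet_def H of_real_diff of_real_mult re complex_norm_square [symmetric] by simp
  also have "\<dots> = (C * cnj C) * ((a * b' - a' * b) * cnj (a * b' - a' * b))"
    by (simp add: algebra_simps)
  also have "\<dots> = of_real ((cmod C)\<^sup>2 * (cmod (a * b' - a' * b))\<^sup>2)"
    by (simp only: complex_norm_square of_real_mult)
  finally show ?thesis using of_real_eq_iff by blast
qed

section \<open>The two-qubit inequality\<close>

definition definite :: "complex^4^4 \<Rightarrow> bool" where
  "definite R \<longleftrightarrow> (\<forall>v. v \<noteq> 0 \<longrightarrow> (\<Sum>i\<in>UNIV. \<Sum>j\<in>UNIV. cnj (v $ i) * R $ i $ j * v $ j) \<noteq> 0)"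

text \<open>The form of \<open>gram Z\<close> at the conjugate of \<open>y\<close> is the squared
  norm of \<open>Z *v y\<close>.\<close>

lemma definite_gram_ker:
  fixes Z :: "complex^4^'n::finite"
  assumes "definite (gram Z)" "Z *v y = 0"
  shows "y = 0"
proof (rule ccontr)
  assume "y \<noteq> 0"
  define v :: "complex^4" where "v = (\<chi> i. cnj (y $ i))"
  have "v \<noteq> 0" using \<open>y \<noteq> 0\<close> by (auto simp: v_def vec_eq_iff)
  have z: "(\<Sum>i\<in>UNIV. Z $ c $ i * y $ i) = 0" for c
    using assms(2) by (simp add: vec_eq_iff matrix_vector_mult_def)
  have "(\<Sum>i\<in>UNIV. \<Sum>j\<in>UNIV. cnj (v $ i) * gram Z $ i $ j * v $ j) =
    (\<Sum>i\<in>UNIV. \<Sum>j\<in>UNIV. \<Sum>c\<in>UNIV. (Z $ c $ i * y $ i) * cnj (Z $ c $ j * y $ j))"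
    by (simp add: v_def gram_nth sum_distrib_left sum_distrib_right mult_ac)
  also have "\<dots> = (\<Sum>i\<in>UNIV. \<Sum>c\<in>UNIV. \<Sum>j\<in>UNIV. (Z $ c $ i * y $ i) * cnj (Z $ c $ j * y $ j))"
    by (intro sum.cong sum.swap refl)
  also have "\<dots> = (\<Sum>i\<in>UNIV. \<Sum>c\<in>UNIV. (Z $ c $ i * y $ i) * cnj (\<Sum>j\<in>UNIV. Z $ c $ j * y $ j))"
    by (simp only: sum_distrib_left cnj_sum)
  also have "\<dots> = 0" by (simp only: z complex_cnj_zero mult_zero_right sum.neutral_const)
  finally show False using assms(1) \<open>v \<noteq> 0\<close> unfolding definite_def by blast
qed

text \<open>A member with determinant zero is \<open>qpol\<close>-orthogonal to all members, itself
  included. Definiteness then makes this member zero, and a zero row makes \<open>Z\<close>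
  singular, against definiteness once more.\<close>

lemma definite_gram_qdet_neq_0:
  fixes Z :: "complex^4^4"
  assumes "definite (gram Z)" and orth: "\<And>c d. c \<noteq> d \<Longrightarrow> qpol (Z $ c) (Z $ d) = 0"
  shows "qdet (Z $ c) \<noteq> 0"
proof
  assume 0: "qdet (Z $ c) = 0"
  \<comment> \<open>The coefficient vector of the linear form \<open>qpol\<close> against
    \<open>Z $ c\<close>.\<close>
  define y :: "complex^4" where "y = vector [Z $ c $ 4, - Z $ c $ 3, - Z $ c $ 2, Z $ c $ 1]"
  have "qpol (Z $ d) (Z $ c) = 0" for d
    using orth [of d c] 0 by (cases "d = c") (auto simp: qpol_def qdet_def algebra_simps)
  then have "Z *v y = 0"
    by (simp add: vec_eq_iff matrix_vector_mult_def y_def sum_4 qpol_def algebra_simps)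
  then have "y = 0" using definite_gram_ker assms(1) by blast
  then have "Z $ c = 0" by (simp add: y_def vec_eq_iff forall_4)
  then have "det Z = 0" by (intro det_zero_row) (simp add: row_def vec_eq_iff)
  then have "\<not> (\<exists>B. B ** Z = mat 1)"
    using invertible_det_nz invertible_left_inverse by blast
  then obtain u where "Z *v u = 0" "u \<noteq> 0" unfolding matrix_left_invertible_ker by blast
  then show False using definite_gram_ker assms(1) by blast
qed

text \<open>The new members combine the old ones with the signs of a Hadamard matrix and the phases
  1, \<open>\<i>\<close>, \<open>p\<close>, \<open>q\<close>. By orthogonality only squares of signs
  enter the determinants, so all four agree.\<close>

lemma hadamard_ensemble:
  fixes Z :: "complex^4^4"
  assumes orth: "\<And>c d. c \<noteq> d \<Longrightarrow> qpol (Z $ c) (Z $ d) = 0"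
    and d: "\<And>c. qdet (Z $ c) = of_real (d c)"
  obtains Y :: "complex^4^4" where "gram Y = gram Z"
    "(\<Sum>c\<in>UNIV. cmod (qdet (Y $ c))) = \<bar>\<bar>d 1 - d 2\<bar> - \<bar>d 3 - d 4\<bar>\<bar>"
proof -
  \<comment> \<open>The sign \<open>s\<close> is 1 or -1, chosen such that the two differences work
    against each other; the phases realise it through their squares.\<close>
  obtain p q :: complex where pq: "p * cnj p = 1" "q * cnj q = 1"
    and s: "\<exists>s. p\<^sup>2 = of_real s \<and> q\<^sup>2 = - of_real s \<and> \<bar>d 1 - d 2 + s * (d 3 - d 4)\<bar> = \<bar>\<bar>d 1 - d 2\<bar> - \<bar>d 3 - d 4\<bar>\<bar>"
  proof (cases "(d 1 - d 2) * (d 3 - d 4) \<ge> 0")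
    case True
    then have "\<bar>d 1 - d 2 + (-1) * (d 3 - d 4)\<bar> = \<bar>\<bar>d 1 - d 2\<bar> - \<bar>d 3 - d 4\<bar>\<bar>"
      by (auto simp: zero_le_mult_iff)
    then show ?thesis using that [of \<i> 1] by (metis complex_cnj_i complex_cnj_one i_squared minus_minus
      mult.right_neutral mult_minus_right of_real_1 of_real_minus one_power2 power2_eq_square)
  next
    case False
    then have "\<bar>d 1 - d 2 + 1 * (d 3 - d 4)\<bar> = \<bar>\<bar>d 1 - d 2\<bar> - \<bar>d 3 - d 4\<bar>\<bar>"
      by (auto simp: zero_le_mult_iff)
    then show ?thesis using that [of 1 \<i>] by (metis complex_cnj_i complex_cnj_one i_squared minus_minus
      mult.right_neutral mult_minus_right of_real_1 one_power2 power2_eq_square)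
  qed
  then obtain s where s: "p\<^sup>2 = of_real s" "q\<^sup>2 = - of_real s"
    and ds: "\<bar>d 1 - d 2 + s * (d 3 - d 4)\<bar> = \<bar>\<bar>d 1 - d 2\<bar> - \<bar>d 3 - d 4\<bar>\<bar>" by blast
  define f where "f a b c = (1/2) *s (Z $ 1 + (a * \<i>) *s Z $ 2 + (b * p) *s Z $ 3 + (c * q) *s Z $ 4)"
    for a b c :: complex
  define Y :: "complex^4^4" where "Y = vector [f 1 1 1, f 1 (-1) (-1), f (-1) 1 (-1), f (-1) (-1) 1]"
  have Y: "Y $ 1 = f 1 1 1" "Y $ 2 = f 1 (-1) (-1)" "Y $ 3 = f (-1) 1 (-1)" "Y $ 4 = f (-1) (-1) 1"
    by (simp_all add: Y_def)
  have "gram Y $ i $ j = gram Z $ i $ j" for i j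
  proof -
    have "gram Y $ i $ j = Z $ 1 $ i * cnj (Z $ 1 $ j) + Z $ 2 $ i * cnj (Z $ 2 $ j)
       + (p * cnj p) * (Z $ 3 $ i * cnj (Z $ 3 $ j)) + (q * cnj q) * (Z $ 4 $ i * cnj (Z $ 4 $ j))"
      unfolding gram_nth sum_4 Y f_def by (simp add: field_simps)
    then show ?thesis unfolding pq gram_nth sum_4 by simp
  qed
  moreover have "qdet (f a b c) = of_real ((d 1 - d 2 + s * (d 3 - d 4)) / 4)"
    if "a * a = 1" "b * b = 1" "c * c = 1" for a b c
  proof -
    have "4 * qdet (f a b c) = qdet (Z $ 1) - (a * a) * qdet (Z $ 2) + (b * b) * p\<^sup>2 * qdet (Z $ 3)
      + (c * c) * q\<^sup>2 * qdet (Z $ 4) + a * \<i> * qpol (Z $ 1) (Z $ 2) + b * p * qpol (Z $ 1) (Z $ 3)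
      + c * q * qpol (Z $ 1) (Z $ 4) + a * \<i> * b * p * qpol (Z $ 2) (Z $ 3)
      + a * \<i> * c * q * qpol (Z $ 2) (Z $ 4) + b * p * c * q * qpol (Z $ 3) (Z $ 4)"
      by (simp add: f_def qdet_def qpol_def power2_eq_square field_simps)
    also have "\<dots> = of_real (d 1 - d 2 + s * (d 3 - d 4))"
      unfolding that s d by (simp add: orth algebra_simps)
    finally show ?thesis by (simp add: field_simps)
  qed
  then have qY: "cmod (qdet (Y $ c)) = \<bar>\<bar>d 1 - d 2\<bar> - \<bar>d 3 - d 4\<bar>\<bar> / 4" for c
    using exhaust_4 [of c] ds by (auto simp: Y norm_of_real simp del: of_real_divide of_real_diff of_real_add of_real_mult)
  then have "(\<Sum>c\<in>UNIV. cmod (qdet (Y $ c))) = \<bar>\<bar>d 1 - d 2\<bar> - \<bar>d 3 - d 4\<bar>\<bar>"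
    unfolding sum_4 qY by simp
  ultimately show ?thesis using that [of Y] by (simp add: vec_eq_iff)
qed

text \<open>With a Hermitian form isotropic on \<open>v1\<close> and \<open>v2\<close>, each member
  contributes only through the cross value \<open>H\<close>, and the matrix left on the first qubit
  is off-diagonal in terms of \<open>w1\<close> and \<open>w2\<close>, with entry
  \<open>C\<close>.\<close>

lemma hdet_tetrad:
  fixes Z :: "complex^4^4" and w1 w2 v1 v2 :: "complex^2"
  assumes Z: "Z $ 1 = of_real (sqrt d1) *s (tens w1 v1 + tens w2 v2)"
      "Z $ 2 = (\<i> * of_real (sqrt d2)) *s (tens w1 v1 - tens w2 v2)"
      "Z $ 3 = of_real (sqrt d3) *s (\<kappa> *s tens w1 v2 + \<kappa>' *s tens w2 v1)"
      "Z $ 4 = (u * of_real (sqrt d4)) *s (\<kappa> *s tens w1 v2 - \<kappa>' *s tens w2 v1)"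
    and nonneg: "0 \<le> d1" "0 \<le> d2" "0 \<le> d3" "0 \<le> d4" and u: "u * cnj u = 1"
    and \<kappa>: "cmod (\<kappa> * \<kappa>') = 1" and det: "det2 w1 w2 * det2 v1 v2 = 1"
  obtains x y where "x\<^sup>2 + (cmod y)\<^sup>2 = 1" "(\<bar>d1 - d2\<bar> - \<bar>d3 - d4\<bar>)\<^sup>2 \<le> hdet (gram Z) x y"
proof -
  obtain x y where xy: "x\<^sup>2 + (cmod y)\<^sup>2 = 1"
    and iso: "hform x y (v1 $ 1) (v1 $ 2) (v1 $ 1) (v1 $ 2) = 0" "hform x y (v2 $ 1) (v2 $ 2) (v2 $ 1) (v2 $ 2) = 0"
    by (rule exists_isotropic_pair)
  define H where "H = hform x y (v1 $ 1) (v1 $ 2) (v2 $ 1) (v2 $ 2)"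
  note comb = hform_comb [OF iso, folded H_def]
  \<comment> \<open>The members 1 and 2 contribute the first summand, 3 and 4 the second, where the
    exchange of \<open>v1\<close> and \<open>v2\<close> conjugates \<open>H\<close>.\<close>
  define C where "C = of_real (d1 - d2) * H + of_real (d3 - d4) * (\<kappa> * cnj \<kappa>' * cnj H)"
  have sq: "complex_of_real (sqrt d) * of_real (sqrt d) = of_real d" if "0 \<le> d" for d
    using that by (simp flip: of_real_mult)
  \<comment> \<open>Here \<open>i\<close>, \<open>i'\<close> are the coordinates with first-qubit
    index \<open>a\<close>, and \<open>j\<close>, \<open>j'\<close> those with index
    \<open>b\<close>.\<close>
  have hm: "hmat (gram Z) x y i i' j j' = C * w1 $ a * cnj (w2 $ b) + cnj C * w2 $ a * cnj (w1 $ b)"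
    if ij: "\<And>w v. tens w v $ i = w $ a * v $ 1" "\<And>w v. tens w v $ i' = w $ a * v $ 2"
      "\<And>w v. tens w v $ j = w $ b * v $ 1" "\<And>w v. tens w v $ j' = w $ b * v $ 2" for i i' j j' a b
  proof -
    have h: "hform x y (Z $ c $ i) (Z $ c $ i') (Z $ c $ j) (Z $ c $ j') =
        (r * cnj r) * ((\<alpha> a * cnj (\<beta> b)) * H + (\<beta> a * cnj (\<alpha> b)) * cnj H)"
      if "\<And>l m e. (\<And>w v. tens w v $ l = w $ m * v $ e) \<Longrightarrow> Z $ c $ l = r * (\<alpha> m * v1 $ e + \<beta> m * v2 $ e)"
      for c r \<alpha> \<beta>
      unfolding that [OF ij(1)] that [OF ij(2)] that [OF ij(3)] that [OF ij(4)] hform_smult comb by simp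
    have 1: "hform x y (Z $ 1 $ i) (Z $ 1 $ i') (Z $ 1 $ j) (Z $ 1 $ j') =
      (of_real (sqrt d1) * cnj (of_real (sqrt d1))) * ((w1 $ a * cnj (w2 $ b)) * H + (w2 $ a * cnj (w1 $ b)) * cnj H)"
      by (rule h) (simp add: Z(1) algebra_simps)
    have 2: "hform x y (Z $ 2 $ i) (Z $ 2 $ i') (Z $ 2 $ j) (Z $ 2 $ j') =
      ((\<i> * of_real (sqrt d2)) * cnj (\<i> * of_real (sqrt d2))) *
      ((w1 $ a * cnj (- w2 $ b)) * H + ((- w2 $ a) * cnj (w1 $ b)) * cnj H)"
      by (rule h [where \<beta> = "\<lambda>m. - w2 $ m"]) (simp add: Z(2) algebra_simps)
    have 3: "hform x y (Z $ 3 $ i) (Z $ 3 $ i') (Z $ 3 $ j) (Z $ 3 $ j') =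
      (of_real (sqrt d3) * cnj (of_real (sqrt d3))) *
      (((\<kappa>' * w2 $ a) * cnj (\<kappa> * w1 $ b)) * H + ((\<kappa> * w1 $ a) * cnj (\<kappa>' * w2 $ b)) * cnj H)"
      by (rule h [where \<alpha> = "\<lambda>m. \<kappa>' * w2 $ m" and \<beta> = "\<lambda>m. \<kappa> * w1 $ m"])
        (simp add: Z(3) algebra_simps)
    have 4: "hform x y (Z $ 4 $ i) (Z $ 4 $ i') (Z $ 4 $ j) (Z $ 4 $ j') =
      ((u * of_real (sqrt d4)) * cnj (u * of_real (sqrt d4))) *
      (((- (\<kappa>' * w2 $ a)) * cnj (\<kappa> * w1 $ b)) * H + ((\<kappa> * w1 $ a) * cnj (- (\<kappa>' * w2 $ b))) * cnj H)"
      by (rule h [where \<alpha> = "\<lambda>m. - (\<kappa>' * w2 $ m)" and \<beta> = "\<lambda>m. \<kappa> * w1 $ m"])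
        (simp add: Z(4) algebra_simps)
    have r: "of_real (sqrt d1) * cnj (of_real (sqrt d1)) = complex_of_real d1"
      "(\<i> * of_real (sqrt d2)) * cnj (\<i> * of_real (sqrt d2)) = complex_of_real d2"
      "of_real (sqrt d3) * cnj (of_real (sqrt d3)) = complex_of_real d3"
      using sq [OF nonneg(1)] sq [OF nonneg(2)] sq [OF nonneg(3)]
      by (simp_all add: algebra_simps)
    have "(u * of_real (sqrt d4)) * cnj (u * of_real (sqrt d4)) = (u * cnj u) * (of_real (sqrt d4) * of_real (sqrt d4))"
      by (simp add: mult_ac)
    then have r4: "(u * of_real (sqrt d4)) * cnj (u * of_real (sqrt d4)) = complex_of_real d4"
      using nonneg u by (simp add: sq)
    show ?thesis
      unfolding hmat_gram sum_4 1 2 3 4 r r4 C_def by (simp add: algebra_simps)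
  qed
  have "hdet (gram Z) x y = (cmod C)\<^sup>2 * (cmod (w1 $ 1 * w2 $ 2 - w1 $ 2 * w2 $ 1))\<^sup>2"
    by (rule hdet_offdiagonal; rule hm) simp_all
  moreover have "(\<bar>d1 - d2\<bar> - \<bar>d3 - d4\<bar>)\<^sup>2 * (cmod H)\<^sup>2 \<le> (cmod C)\<^sup>2"
  proof -
    have "cmod (\<kappa> * cnj \<kappa>' * cnj H) = cmod H" using \<kappa> by (simp add: norm_mult)
    then have "\<bar>\<bar>d1 - d2\<bar> * cmod H - \<bar>d3 - d4\<bar> * cmod H\<bar> \<le> cmod C"
      unfolding C_def using norm_triangle_ineq3 [of "of_real (d1 - d2) * H" "- (of_real (d3 - d4) * (\<kappa> * cnj \<kappa>' * cnj H))"]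
      by (simp only: norm_mult norm_of_real norm_minus_cancel diff_minus_eq_add)
    from power_mono [OF this abs_ge_zero, of 2]
    have "(\<bar>d1 - d2\<bar> * cmod H - \<bar>d3 - d4\<bar> * cmod H)\<^sup>2 \<le> (cmod C)\<^sup>2"
      by (simp only: power2_abs)
    then show ?thesis by (simp add: power_mult_distrib flip: left_diff_distrib)
  qed
  \<comment> \<open>By isotropy \<open>cmod H\<close> is the modulus of \<open>det2 v1 v2\<close>,
    the reciprocal of that of \<open>det2 w1 w2\<close>.\<close>
  moreover have "cmod H * cmod (w1 $ 1 * w2 $ 2 - w1 $ 2 * w2 $ 1) = 1"
    using cmod_hform_isotropic [OF iso xy, folded H_def] arg_cong [OF det, of cmod]
    by (simp add: det2_def norm_mult mult.commute)
  ultimately have "(\<bar>d1 - d2\<bar> - \<bar>d3 - d4\<bar>)\<^sup>2 \<le> hdet (gram Z) x y"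
    by (metis (no_types, lifting) mult.assoc mult.right_neutral mult_right_mono power_mult_distrib power_one zero_le_power2)
  then show ?thesis using that xy by blast
qed

text \<open>Scaled to determinant one, the Takagi members are an orthonormal basis for
  \<open>qdet\<close>, to which the null tetrad applies. The lower bound for \<open>hdet\<close> is
  the square of the total that the Hadamard mixture attains.\<close>

lemma two_qubit_definite:
  fixes Z0 :: "complex^4^4"
  assumes "definite (gram Z0)"
  shows "\<exists>Y :: complex^4^4. \<exists>x y. gram Y = gram Z0 \<and> x\<^sup>2 + (cmod y)\<^sup>2 = 1
    \<and> (\<Sum>c\<in>UNIV. cmod (qdet (Y $ c)))\<^sup>2 \<le> hdet (gram Z0) x y"
proof -
  obtain Z :: "complex^4^4" where Z: "gram Z = gram Z0"
    and real: "\<And>c. qdet (Z $ c) \<in> \<real> \<and> 0 \<le> Re (qdet (Z $ c))"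
    and orth: "\<And>c d. c \<noteq> d \<Longrightarrow> qpol (Z $ c) (Z $ d) = 0"
    by (rule takagi_ensemble [of Z0]) blast
  define d where "d c = Re (qdet (Z $ c))" for c
  have d: "qdet (Z $ c) = of_real (d c)" for c
    using real [of c] by (simp add: d_def complex_is_Real_iff complex_eq_iff)
  have "qdet (Z $ c) \<noteq> 0" for c
    using definite_gram_qdet_neq_0 [of Z] assms orth Z by metis
  then have dpos: "0 < d c" for c
    using real [of c] d [of c] by (metis d_def of_real_0 order_le_less)
  define r where "r c = complex_of_real (sqrt (d c))" for c
  have r: "r c * r c = of_real (d c)" "r c \<noteq> 0" for c
    using dpos [of c] by (simp_all add: r_def flip: of_real_mult)
  define P where "P c = (1 / r c) *s Z $ c" for c
  have ZP: "Z $ c = r c *s P c" for c using r(2) by (simp add: P_def vec_eq_iff)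
  have qP: "qdet (P c) = 1" for c
  proof -
    have "qdet (P c) = qdet (Z $ c) / (r c * r c)" by (simp add: P_def qdet_def diff_divide_distrib)
    then show ?thesis using r d dpos [of c] by simp
  qed
  have oP: "qpol (P c) (P e) = 0" if "c \<noteq> e" for c e
    using orth [OF that] by (simp add: P_def qpol_smult)
  have sP: "qpol (P c) (P c) = 2" for c
    using qP [of c] by (simp add: qdet_def qpol_def algebra_simps)
  define E where "E c e s = (1/2) *s (P c + s *s P e)" for c e and s :: complex
  have qE: "qdet (E c e s) = 0" if "c \<noteq> e" "s * s = -1" for c e s
  proof -
    have "4 * qdet (E c e s) = qdet (P c) + (s * s) * qdet (P e) + s * qpol (P c) (P e)"
      by (simp add: E_def qdet_def qpol_def field_simps)
    then show ?thesis using that oP qP by simp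
  qed
  have pE: "qpol (E c e s) (E c' e' s') = (qpol (P c) (P c') + s' * qpol (P c) (P e')
     + s * qpol (P e) (P c') + s * s' * qpol (P e) (P e')) / 4" for c e s c' e' s'
    by (simp add: E_def qpol_def field_simps)
  obtain w1 w2 v1 v2 \<kappa> \<kappa>' where t: "E 1 2 (-\<i>) = tens w1 v1" "E 1 2 \<i> = tens w2 v2"
    "E 3 4 \<i> = \<kappa> *s tens w1 v2 \<and> E 3 4 (-\<i>) = \<kappa>' *s tens w2 v1
     \<or> E 3 4 (-\<i>) = \<kappa> *s tens w1 v2 \<and> E 3 4 \<i> = \<kappa>' *s tens w2 v1"
    "det2 w1 w2 * det2 v1 v2 = 1" "\<kappa> * \<kappa>' = -1"
    by (rule null_tetrad [of "E 1 2 (-\<i>)" "E 1 2 \<i>" "E 3 4 \<i>" "E 3 4 (-\<i>)"])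
      (simp_all add: qE pE oP sP)
  have P: "P c = E c e \<i> + E c e (-\<i>)" "P e = \<i> *s (E c e (-\<i>) - E c e \<i>)" for c e
    by (simp_all add: E_def vec_eq_iff algebra_simps)
  \<comment> \<open>Which of the two isotropic combinations of \<open>P 3\<close> and
    \<open>P 4\<close> is parallel to \<open>tens w1 v2\<close> is undetermined; exchanging them
    only changes the sign of \<open>u\<close>.\<close>
  obtain u where u: "u * cnj u = 1" "P 3 = \<kappa> *s tens w1 v2 + \<kappa>' *s tens w2 v1"
    "P 4 = u *s (\<kappa> *s tens w1 v2 - \<kappa>' *s tens w2 v1)"
  proof (cases "E 3 4 \<i> = \<kappa> *s tens w1 v2 \<and> E 3 4 (-\<i>) = \<kappa>' *s tens w2 v1")
    case True
    then show ?thesis using that [of "-\<i>"] P(1) [of 3 4] P(2) [where c = 3 and e = 4] by (simp add: vec_eq_iff algebra_simps)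
  next
    case False
    then have "E 3 4 (-\<i>) = \<kappa> *s tens w1 v2 \<and> E 3 4 \<i> = \<kappa>' *s tens w2 v1" using t(3) by blast
    then show ?thesis using that [of "\<i>"] P(1) [of 3 4] P(2) [where c = 3 and e = 4] by (simp add: vec_eq_iff algebra_simps)
  qed
  have P12: "P 1 = tens w1 v1 + tens w2 v2" "P 2 = \<i> *s (tens w1 v1 - tens w2 v2)"
    using P(1) [of 1 2] P(2) [where c = 1 and e = 2] t(1,2) by (simp_all add: add.commute)
  obtain x y where xy: "x\<^sup>2 + (cmod y)\<^sup>2 = 1"
    and hd: "(\<bar>d 1 - d 2\<bar> - \<bar>d 3 - d 4\<bar>)\<^sup>2 \<le> hdet (gram Z) x y"
  proof (rule hdet_tetrad [of Z "d 1" w1 v1 w2 v2 "d 2" "d 3" \<kappa> \<kappa>' u "d 4"])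
    show "Z $ 1 = of_real (sqrt (d 1)) *s (tens w1 v1 + tens w2 v2)"
      using ZP [of 1] P12 by (simp add: r_def)
    show "Z $ 2 = (\<i> * of_real (sqrt (d 2))) *s (tens w1 v1 - tens w2 v2)"
      using ZP [of 2] P12 by (simp add: r_def vec_eq_iff mult_ac)
    show "Z $ 3 = of_real (sqrt (d 3)) *s (\<kappa> *s tens w1 v2 + \<kappa>' *s tens w2 v1)"
      using ZP [of 3] u by (simp add: r_def)
    show "Z $ 4 = (u * of_real (sqrt (d 4))) *s (\<kappa> *s tens w1 v2 - \<kappa>' *s tens w2 v1)"
      using ZP [of 4] u by (simp add: r_def vec_eq_iff mult_ac)
  qed (use dpos u t in \<open>auto simp: less_imp_le\<close>)
  obtain Y :: "complex^4^4" where "gram Y = gram Z"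
    "(\<Sum>c\<in>UNIV. cmod (qdet (Y $ c))) = \<bar>\<bar>d 1 - d 2\<bar> - \<bar>d 3 - d 4\<bar>\<bar>"
    using hadamard_ensemble [OF orth d] by metis
  then show ?thesis using xy hd Z by (intro exI [of _ Y] exI [of _ x] exI [of _ y]) simp
qed

text \<open>Adding a small multiple of the identity makes \<open>R\<close> definite, and solutions
  for the perturbed matrices survive the limit by compactness.\<close>

lemma two_qubit_ensemble:
  fixes R :: "complex^4^4"
  assumes psd: "pos_semidef UNIV (\<lambda>i j. R $ i $ j)"
  obtains Y :: "complex^4^4" and x y where "gram Y = R" "x\<^sup>2 + (cmod y)\<^sup>2 = 1"
    "(\<Sum>c\<in>UNIV. cmod (qdet (Y $ c)))\<^sup>2 \<le> hdet R x y"
proof -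
  define \<epsilon> where "\<epsilon> n = inverse (real (Suc n))" for n
  define Rn where "Rn n = R + mat (of_real (\<epsilon> n))" for n
  have Rn_nth: "Rn n $ i $ j = R $ i $ j + (if i = j then of_real (\<epsilon> n) else 0)" for n i j
    by (simp add: Rn_def mat_def)
  have \<epsilon>: "0 < \<epsilon> n" for n by (simp add: \<epsilon>_def)
  have form: "(\<Sum>i\<in>UNIV. \<Sum>j\<in>UNIV. cnj (v i) * Rn n $ i $ j * v j) =
    (\<Sum>i\<in>UNIV. \<Sum>j\<in>UNIV. cnj (v i) * R $ i $ j * v j) + of_real (\<epsilon> n * (\<Sum>i\<in>UNIV. (cmod (v i))\<^sup>2))" for n v
  proof -
    have "(\<Sum>j\<in>UNIV. cnj (v i) * Rn n $ i $ j * v j) =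
        (\<Sum>j\<in>UNIV. cnj (v i) * R $ i $ j * v j) + of_real (\<epsilon> n) * of_real ((cmod (v i))\<^sup>2)" for i
    proof -
      have "cnj (v i) * Rn n $ i $ j * v j = cnj (v i) * R $ i $ j * v j
          + (if i = j then of_real (\<epsilon> n) * of_real ((cmod (v i))\<^sup>2) else 0)" for j
        unfolding Rn_nth complex_norm_square by (simp add: algebra_simps)
      then show ?thesis by (simp add: sum.distrib)
    qed
    then show ?thesis by (simp add: sum.distrib sum_distrib_left)
  qed
  have psd0: "0 \<le> Re (\<Sum>i\<in>UNIV. \<Sum>j\<in>UNIV. cnj (v i) * R $ i $ j * v j)" for v
    using psd unfolding pos_semidef_def by blast
  have psdn: "pos_semidef UNIV (\<lambda>i j. Rn n $ i $ j)" for n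
    unfolding pos_semidef_def
  proof (intro conjI ballI allI)
    have "cnj (R $ i $ j) = R $ j $ i" for i j
    proof -
      have "R $ j $ i = cnj (R $ i $ j)" using psd unfolding pos_semidef_def by blast
      then show ?thesis by (rule sym)
    qed
    then show "Rn n $ j $ i = cnj (Rn n $ i $ j)" for i j
      unfolding Rn_nth by simp
    show "0 \<le> Re (\<Sum>i\<in>UNIV. \<Sum>j\<in>UNIV. cnj (v i) * Rn n $ i $ j * v j)" for v
      unfolding form using psd0 [of v] \<epsilon> [of n] by (simp add: sum_nonneg)
  qed
  have def: "definite (Rn n)" for n
    unfolding definite_def
  proof (intro allI impI)
    fix v :: "complex^4" assume "v \<noteq> 0"
    then have "0 < (norm v)\<^sup>2" by simp
    also have "(norm v)\<^sup>2 = (\<Sum>i\<in>UNIV. (cmod (v $ i))\<^sup>2)"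
      by (simp add: norm_vec_def L2_set_def sum_nonneg)
    finally have "0 < \<epsilon> n * (\<Sum>i\<in>UNIV. (cmod (v $ i))\<^sup>2)" using \<epsilon> by simp
    then have "0 < Re (\<Sum>i\<in>UNIV. \<Sum>j\<in>UNIV. cnj (v $ i) * Rn n $ i $ j * v $ j)"
      unfolding form using psd0 [of "($) v"] by simp
    then show "(\<Sum>i\<in>UNIV. \<Sum>j\<in>UNIV. cnj (v $ i) * Rn n $ i $ j * v $ j) \<noteq> 0" by force
  qed
  have ex: "\<exists>Z0 :: complex^4^4. gram Z0 = Rn n" for n
  proof -
    obtain w :: "4 \<Rightarrow> 4 \<Rightarrow> complex" where "\<forall>i\<in>UNIV. \<forall>j\<in>UNIV. Rn n $ i $ j = (\<Sum>c\<in>UNIV. w c i * cnj (w c j))"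
      using pos_semidef_imp_gram [OF _ psdn [of n]] by auto
    then show ?thesis by (intro exI [of _ "\<chi> c i. w c i"]) (simp add: vec_eq_iff gram_nth)
  qed
  have \<epsilon>0: "\<epsilon> \<longlonglongrightarrow> 0" unfolding \<epsilon>_def by (rule LIMSEQ_inverse_real_of_nat)
  have lim: "Rn \<longlonglongrightarrow> R"
  proof (intro vec_tendstoI)
    fix i j
    have "(\<lambda>n. R $ i $ j + of_real (\<epsilon> n) * (if i = j then 1 else 0)) \<longlonglongrightarrow> R $ i $ j + of_real 0 * (if i = j then 1 else 0)"
      by (intro tendsto_intros \<epsilon>0)
    then show "(\<lambda>n. Rn n $ i $ j) \<longlonglongrightarrow> R $ i $ j"
      by (cases "i = j") (simp_all add: Rn_nth)
  qed
  obtain B where B: "\<And>n. norm (Rn n) \<le> B"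
    using convergent_imp_bounded [OF lim] by (auto simp: bounded_iff)
  \<comment> \<open>All solutions whose density matrix has norm at most \<open>B\<close>. As
    \<open>T\<close> is compact, the matrices that have a solution form a closed set, which contains
    every \<open>Rn n\<close> and hence \<open>R\<close>.\<close>
  define T where "T = ({Z :: complex^4^4. gram Z \<in> cball 0 B} \<times> sphere (0 :: real \<times> complex) 1) \<inter>
    {q. (\<Sum>c\<in>UNIV. cmod (qdet (fst q $ c)))\<^sup>2 \<le> hdet (gram (fst q)) (fst (snd q)) (snd (snd q))}"
  have cg: "continuous_on UNIV (\<lambda>q :: (complex^4^4) \<times> real \<times> complex. gram (fst q))"
    by (rule continuous_on_compose2 [OF continuous_on_gram]) (auto intro!: continuous_intros)
  have "compact T"
    unfolding T_def hdet_def hmat_def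
    by (intro compact_Int_closed compact_Times compact_gram_vimage compact_cball compact_sphere closed_Collect_le
        continuous_intros cg)
  then have "compact ((\<lambda>q. gram (fst q)) ` T)"
    by (intro compact_continuous_image continuous_on_subset [OF cg]) auto
  then have "closed ((\<lambda>q. gram (fst q)) ` T)" by (rule compact_imp_closed)
  moreover have "Rn n \<in> (\<lambda>q. gram (fst q)) ` T" for n
  proof -
    obtain Z0 :: "complex^4^4" where Z0: "gram Z0 = Rn n" using ex by blast
    obtain Y :: "complex^4^4" and x y where "gram Y = Rn n" "x\<^sup>2 + (cmod y)\<^sup>2 = 1"
      "(\<Sum>c\<in>UNIV. cmod (qdet (Y $ c)))\<^sup>2 \<le> hdet (Rn n) x y"
      using two_qubit_definite [of Z0] def [of n] unfolding Z0 by blast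
    then have "(Y, x, y) \<in> T" "Rn n = gram (fst (Y, x, y))"
      using B [of n] by (simp_all add: T_def norm_Pair)
    then show ?thesis by blast
  qed
  ultimately have "R \<in> (\<lambda>q. gram (fst q)) ` T"
    using closed_sequentially lim by blast
  then obtain Y x y where "(Y, x, y) \<in> T" "R = gram Y" by auto
  then show ?thesis using that [of Y x y] by (auto simp: T_def norm_Pair)
qed

section \<open>Convex roofs of unnormalised ensembles\<close>

text \<open>The weight of a member is its squared norm, so no probabilities appear and zero members
  are allowed.\<close>

definition ensemble :: "'q set \<Rightarrow> 'q set cmat \<Rightarrow> 'i set \<Rightarrow> ('i \<Rightarrow> 'q set cvec) \<Rightarrow> bool" where
  "ensemble S \<rho> I w \<longleftrightarrow> finite I \<and> (\<forall>x\<in>Pow S. \<forall>y\<in>Pow S. \<rho> x y = (\<Sum>i\<in>I. w i x * cnj (w i y)))"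

definition ip :: "'q set \<Rightarrow> 'q set cvec \<Rightarrow> 'q set cvec \<Rightarrow> complex" where
  "ip Y f g = (\<Sum>z\<in>Pow Y. f z * cnj (g z))"

text \<open>
  The determinant of the reduced matrix of a qubit \<open>a\<close> for an unnormalised vector of the qubits
  \<open>insert a Y\<close>. The concurrence extends to such vectors homogeneously of degree two.
\<close>

definition vdet :: "'q set \<Rightarrow> 'q \<Rightarrow> 'q set cvec \<Rightarrow> real" where
  "vdet Y a w = Re (ip Y w w) * Re (ip Y (\<lambda>z. w (insert a z)) (\<lambda>z. w (insert a z)))
     - (cmod (ip Y w (\<lambda>z. w (insert a z))))\<^sup>2"

definition vconc :: "'q set \<Rightarrow> 'q \<Rightarrow> 'q set cvec \<Rightarrow> real" where
  "vconc Y a w = 2 * sqrt (vdet Y a w)"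

section \<open>Inner products and marginal determinants\<close>

lemma sum_Pow_Un:
  assumes "finite A" "finite B" "A \<inter> B = {}"
  shows "(\<Sum>x\<in>Pow (A \<union> B). f x) = (\<Sum>x\<in>Pow A. \<Sum>z\<in>Pow B. f (x \<union> z))"
proof -
  have "(\<Sum>x\<in>Pow (A \<union> B). f x) = (\<Sum>q\<in>Pow A \<times> Pow B. f (fst q \<union> snd q))"
    by (rule sum.reindex_bij_witness [where i = "\<lambda>q. fst q \<union> snd q" and j = "\<lambda>x. (x \<inter> A, x \<inter> B)"])
      (use assms(3) in \<open>auto simp: Int_absorb2 simp flip: Int_Un_distrib\<close>)
  then show ?thesis by (simp add: sum.cartesian_product case_prod_unfold)
qed

lemma sum_Pow_insert:
  assumes "finite Y" "a \<notin> Y"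
  shows "(\<Sum>x\<in>Pow (insert a Y). f x) = (\<Sum>z\<in>Pow Y. f z) + (\<Sum>z\<in>Pow Y. f (insert a z))"
proof -
  have "Pow {a} = {{}, {a}}" by auto
  then show ?thesis
    using sum_Pow_Un [of Y "{a}" f] assms by (simp add: sum.distrib)
qed

lemma ip_insert:
  assumes "finite Y" "a \<notin> Y"
  shows "ip (insert a Y) f g = ip Y f g + ip Y (\<lambda>z. f (insert a z)) (\<lambda>z. g (insert a z))"
  unfolding ip_def using assms by (rule sum_Pow_insert)

lemma cnj_ip: "cnj (ip Y f g) = ip Y g f"
  by (simp add: ip_def mult.commute)

lemma ip_self: "ip Y f f = of_real (\<Sum>z\<in>Pow Y. (cmod (f z))\<^sup>2)"
  unfolding ip_def of_real_sum complex_norm_square ..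

lemma ip_comb: "ip Y (\<lambda>z. a * f z + b * g z) (\<lambda>z. c * h z + d * k z) =
  a * cnj c * ip Y f h + a * cnj d * ip Y f k + b * cnj c * ip Y g h + b * cnj d * ip Y g k"
  unfolding ip_def by (simp add: sum_distrib_left sum.distrib algebra_simps)

lemma ip_smult: "ip Y (\<lambda>z. c * f z) (\<lambda>z. d * g z) = c * cnj d * ip Y f g"
  using ip_comb [of Y c f 0 f d g 0 g] by simp

lemma vdet_nonneg: "0 \<le> vdet Y a w"
proof -
  let ?v = "\<lambda>z. w (insert a z)"
  have "cmod (ip Y w ?v) \<le> (\<Sum>z\<in>Pow Y. cmod (w z) * cmod (?v z))"
    unfolding ip_def by (rule sum_norm_le) (simp add: norm_mult)
  then have "(cmod (ip Y w ?v))\<^sup>2 \<le> (\<Sum>z\<in>Pow Y. cmod (w z) * cmod (?v z))\<^sup>2"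
    by (intro power_mono) auto
  also have "\<dots> \<le> (\<Sum>z\<in>Pow Y. (cmod (w z))\<^sup>2) * (\<Sum>z\<in>Pow Y. (cmod (?v z))\<^sup>2)"
    by (rule Cauchy_Schwarz_ineq_sum)
  finally show ?thesis by (simp add: vdet_def ip_self)
qed

lemma vconc_nonneg: "0 \<le> vconc Y a w"
  by (simp add: vconc_def vdet_nonneg)

lemma vconc_smult: "vconc Y a (\<lambda>x. c * w x) = (cmod c)\<^sup>2 * vconc Y a w"
proof -
  have c: "c * cnj c = of_real ((cmod c)\<^sup>2)" by (simp only: complex_norm_square)
  have "vdet Y a (\<lambda>x. c * w x) = ((cmod c)\<^sup>2)\<^sup>2 * vdet Y a w"
    unfolding vdet_def ip_smult c by (simp add: norm_mult power2_eq_square algebra_simps)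
  then show ?thesis by (simp only: vconc_def real_sqrt_mult real_sqrt_abs) simp
qed

text \<open>For a qubit matrix of trace one, 1 minus the trace of its square is twice its
  determinant.\<close>

lemma pure_concurrence_eq_vconc:
  assumes "finite Y" "a \<notin> Y" "pure_state (insert a Y) \<psi>"
  shows "pure_concurrence (insert a Y) {a} \<psi> = vconc Y a \<psi>"
proof -
  define v where "v z = \<psi> (insert a z)" for z
  have Y: "insert a Y - {a} = Y" using assms(2) by auto
  define \<rho> where "\<rho> = reduced (insert a Y) {a} (ketbra \<psi>)"
  have \<rho>: "\<rho> {} {} = ip Y \<psi> \<psi>" "\<rho> {a} {} = cnj (ip Y \<psi> v)" "\<rho> {} {a} = ip Y \<psi> v" "\<rho> {a} {a} = ip Y v v"
    unfolding \<rho>_def reduced_def Y cnj_ip by (simp_all add: ketbra_def ip_def v_def)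
  define p q where "p = Re (ip Y \<psi> \<psi>)" "q = Re (ip Y v v)"
  have pq: "ip Y \<psi> \<psi> = of_real p" "ip Y v v = of_real q"
    by (simp_all add: p_q_def ip_self)
  have "p + q = 1"
    using assms(3) sum_Pow_insert [OF assms(1,2), of "\<lambda>x. (cmod (\<psi> x))\<^sup>2"]
    by (simp add: pure_state_def p_q_def ip_self v_def)
  have "Re (mtrace (Pow {a}) (mmult (Pow {a}) \<rho> \<rho>)) = p\<^sup>2 + q\<^sup>2 + 2 * (cmod (ip Y \<psi> v))\<^sup>2"
    by (simp add: mtrace_def mmult_def Pow_insert \<rho> pq cmod_power2) (simp add: power2_eq_square)
  then have "2 * (1 - Re (mtrace (Pow {a}) (mmult (Pow {a}) \<rho> \<rho>))) = 2\<^sup>2 * vdet Y a \<psi>"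
    using arg_cong [OF \<open>p + q = 1\<close>, of "\<lambda>t. t\<^sup>2"]
    by (simp add: vdet_def v_def [symmetric] p_q_def [symmetric] power2_sum algebra_simps)
  then have "pure_concurrence (insert a Y) {a} \<psi> = sqrt (2\<^sup>2 * vdet Y a \<psi>)"
    unfolding pure_concurrence_def Let_def \<rho>_def by simp
  then show ?thesis by (simp only: vconc_def real_sqrt_mult real_sqrt_abs)
qed

section \<open>Partial traces and bounds for the convex roof\<close>

lemma mtrace_reduced:
  assumes "finite S" "T \<subseteq> S"
  shows "mtrace (Pow T) (reduced S T \<rho>) = mtrace (Pow S) \<rho>"
proof -
  have "finite T" "T \<union> (S - T) = S" using assms finite_subset by auto
  then show ?thesis
    using sum_Pow_Un [of T "S - T" "\<lambda>x. \<rho> x x"] assms by (simp add: mtrace_def reduced_def)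
qed

lemma reduced_reduced:
  assumes "finite S" "T \<subseteq> U" "U \<subseteq> S"
  shows "reduced U T (reduced S U \<rho>) = reduced S T \<rho>"
proof -
  have fin: "finite (U - T)" "finite (S - U)" using assms(1) finite_subset [OF assms(3,1)] by simp_all
  have "(U - T) \<union> (S - U) = S - T" "(U - T) \<inter> (S - U) = {}" using assms by auto
  then have "(\<Sum>z\<in>Pow (S - T). f z) = (\<Sum>z\<in>Pow (U - T). \<Sum>z'\<in>Pow (S - U). f (z \<union> z'))" for f :: "_ \<Rightarrow> complex"
    using sum_Pow_Un [OF fin, of f] by simp
  then show ?thesis by (simp add: reduced_def fun_eq_iff Un_assoc)
qed

text \<open>Tracing out qubits amounts to measuring them in the computational basis: each pair of a
  member and an outcome \<open>z\<close> gives a new member.\<close>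

lemma ensemble_reduced:
  assumes "finite S" "T \<subseteq> S" "ensemble S \<rho> I w"
  shows "ensemble T (reduced S T \<rho>) (I \<times> Pow (S - T)) (\<lambda>q x. w (fst q) (x \<union> snd q))"
  unfolding ensemble_def
proof (intro conjI ballI)
  show "finite (I \<times> Pow (S - T))" using assms by (simp add: ensemble_def)
  fix x y assume xy: "x \<in> Pow T" "y \<in> Pow T"
  have "reduced S T \<rho> x y = (\<Sum>z\<in>Pow (S - T). \<Sum>i\<in>I. w i (x \<union> z) * cnj (w i (y \<union> z)))"
    unfolding reduced_def
  proof (intro sum.cong refl)
    fix z assume "z \<in> Pow (S - T)"
    then have "x \<union> z \<in> Pow S" "y \<union> z \<in> Pow S" using xy assms(2) by auto
    then show "\<rho> (x \<union> z) (y \<union> z) = (\<Sum>i\<in>I. w i (x \<union> z) * cnj (w i (y \<union> z)))"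
      using assms(3) unfolding ensemble_def by blast
  qed
  also have "\<dots> = (\<Sum>i\<in>I. \<Sum>z\<in>Pow (S - T). w i (x \<union> z) * cnj (w i (y \<union> z)))"
    by (rule sum.swap)
  finally show "reduced S T \<rho> x y = (\<Sum>q\<in>I \<times> Pow (S - T). w (fst q) (x \<union> snd q) * cnj (w (fst q) (y \<union> snd q)))"
    by (simp add: sum.cartesian_product case_prod_unfold)
qed

text \<open>Normalising moves the squared norm of a member into its probability; as
  \<open>vconc\<close> has degree two, the average is unchanged.\<close>

lemma ensemble_imp_pure_decomposition:
  assumes "finite Y" "a \<notin> Y" and ens: "ensemble (insert a Y) \<rho> I w"
    and tr: "mtrace (Pow (insert a Y)) \<rho> = 1"
  obtains n p \<psi> where "pure_decomposition (insert a Y) \<rho> n p \<psi>"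
    "(\<Sum>i<n. p i * pure_concurrence (insert a Y) {a} (\<psi> i)) = (\<Sum>i\<in>I. vconc Y a (w i))"
proof -
  define S where "S = insert a Y"
  have finS: "finite (Pow S)" using assms by (simp add: S_def)
  have "finite I" using ens by (simp add: ensemble_def)
  then obtain e where e: "bij_betw e {..<card I} I"
    using ex_bij_betw_nat_finite [of I] by (auto simp: atLeast0LessThan)
  define n where "n = card I"
  define p where "p i = (\<Sum>x\<in>Pow S. (cmod (w (e i) x))\<^sup>2)" for i
  \<comment> \<open>A member of norm zero gets probability 0 and an arbitrary unit vector, here the
    basis vector labelled \<open>{}\<close>.\<close>
  define \<psi> where "\<psi> i = (if p i = 0 then (\<lambda>x. if x = {} then 1 else 0)
     else (\<lambda>x. of_real (1 / sqrt (p i)) * w (e i) x))" for i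
  have p0: "0 \<le> p i" for i unfolding p_def by (rule sum_nonneg) simp
  have w0: "w (e i) x = 0" if "p i = 0" "x \<in> Pow S" for i x
    using that finS by (simp add: p_def sum_nonneg_eq_0_iff del: Pow_iff)
  have pure: "pure_state S (\<psi> i)" for i
  proof (cases "p i = 0")
    case True
    have "(\<Sum>x\<in>Pow S. (cmod (if x = {} then 1 else 0 :: complex))\<^sup>2) = (\<Sum>x\<in>Pow S. if x = {} then 1 else 0)"
      by (intro sum.cong) auto
    then show ?thesis using True finS by (simp add: pure_state_def \<psi>_def)
  next
    case False
    then have "(\<Sum>x\<in>Pow S. (cmod (\<psi> i x))\<^sup>2) = (\<Sum>x\<in>Pow S. (cmod (w (e i) x))\<^sup>2 / p i)"
      using p0 [of i] by (intro sum.cong) (simp_all add: \<psi>_def norm_mult norm_divide power_mult_distrib power_divide)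
    also have "\<dots> = 1" using False by (simp add: p_def flip: sum_divide_distrib)
    finally show ?thesis by (simp add: pure_state_def)
  qed
  have kb: "of_real (p i) * ketbra (\<psi> i) x y = w (e i) x * cnj (w (e i) y)" if "x \<in> Pow S" "y \<in> Pow S" for i x y
  proof (cases "p i = 0")
    case True
    then show ?thesis using w0 [OF True that(1)] by simp
  next
    case False
    then have "complex_of_real (sqrt (p i)) * of_real (sqrt (p i)) = of_real (p i)"
      using p0 [of i] by (simp flip: of_real_mult)
    then show ?thesis using False p0 [of i] by (simp add: ketbra_def \<psi>_def field_simps)
  qed
  have \<rho>: "\<rho> x y = (\<Sum>i<n. w (e i) x * cnj (w (e i) y))" if "x \<in> Pow S" "y \<in> Pow S" for x y
    using ens that sum.reindex_bij_betw [OF e, of "\<lambda>i. w i x * cnj (w i y)"]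
    by (simp add: ensemble_def S_def n_def)
  have "complex_of_real (\<Sum>i<n. p i) = (\<Sum>i<n. \<Sum>x\<in>Pow S. w (e i) x * cnj (w (e i) x))"
    by (simp only: p_def of_real_sum complex_norm_square)
  also have "\<dots> = (\<Sum>x\<in>Pow S. \<Sum>i<n. w (e i) x * cnj (w (e i) x))" by (rule sum.swap)
  also have "\<dots> = mtrace (Pow S) \<rho>" unfolding mtrace_def by (intro sum.cong) (simp_all add: \<rho>)
  finally have "complex_of_real (\<Sum>i<n. p i) = of_real 1" using tr by (simp add: S_def)
  then have sp: "(\<Sum>i<n. p i) = 1" using of_real_eq_iff by blast
  have dec: "pure_decomposition S \<rho> n p \<psi>"
    unfolding pure_decomposition_def using p0 pure sp by (simp add: \<rho> kb del: Pow_iff)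
  have "p i * pure_concurrence S {a} (\<psi> i) = vconc Y a (w (e i))" for i
  proof -
    have *: "pure_concurrence S {a} (\<psi> i) = vconc Y a (\<psi> i)"
      unfolding S_def using assms(1,2) pure [of i] by (intro pure_concurrence_eq_vconc) (simp_all add: S_def)
    show ?thesis
    proof (cases "p i = 0")
      case True
      have "w (e i) z = 0" "w (e i) (insert a z) = 0" if "z \<in> Pow Y" for z
        using w0 [OF True, of z] w0 [OF True, of "insert a z"] that by (auto simp: S_def)
      then have "ip Y (w (e i)) v = 0" for v
        by (simp add: ip_def)
      then show ?thesis using True by (simp add: vconc_def vdet_def)
    next
      case False
      then have "vconc Y a (\<psi> i) = 1 / p i * vconc Y a (w (e i))"
        using vconc_smult [of Y a "of_real (1 / sqrt (p i))" "w (e i)"] p0 [of i]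
        by (simp add: \<psi>_def power_divide norm_divide)
      then show ?thesis using * False by simp
    qed
  qed
  then have "(\<Sum>i<n. p i * pure_concurrence S {a} (\<psi> i)) = (\<Sum>i\<in>I. vconc Y a (w i))"
    using sum.reindex_bij_betw [OF e, of "\<lambda>i. vconc Y a (w i)"] by (simp add: n_def)
  then show ?thesis using that dec by (simp add: S_def)
qed

context
  fixes Y :: "'q set" and a :: 'q and \<rho> :: "'q set cmat"
  assumes Y: "finite Y" "a \<notin> Y" and tr: "mtrace (Pow (insert a Y)) \<rho> = 1"
begin

lemma pure_decomposition_concurrence_nonneg:
  assumes "pure_decomposition (insert a Y) \<rho> n p \<psi>"
  shows "0 \<le> (\<Sum>i<n. p i * pure_concurrence (insert a Y) {a} (\<psi> i))"
proof (rule sum_nonneg)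
  fix i assume "i \<in> {..<n}"
  then have "0 \<le> p i" "pure_state (insert a Y) (\<psi> i)"
    using assms by (auto simp: pure_decomposition_def)
  then show "0 \<le> p i * pure_concurrence (insert a Y) {a} (\<psi> i)"
    by (simp add: pure_concurrence_eq_vconc Y vconc_nonneg)
qed

lemma concurrence_le:
  assumes "ensemble (insert a Y) \<rho> I w"
  shows "concurrence (insert a Y) {a} \<rho> \<le> (\<Sum>i\<in>I. vconc Y a (w i))"
proof -
  obtain n p \<psi> where "pure_decomposition (insert a Y) \<rho> n p \<psi>"
    "(\<Sum>i<n. p i * pure_concurrence (insert a Y) {a} (\<psi> i)) = (\<Sum>i\<in>I. vconc Y a (w i))"
    using ensemble_imp_pure_decomposition [OF Y assms tr] .
  then show ?thesis unfolding concurrence_def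
    by (intro cInf_lower bdd_belowI [of _ 0])
      (auto intro: pure_decomposition_concurrence_nonneg, metis)
qed

text \<open>The ensemble witnesses that decompositions exist; the infimum of the empty set would be
  unspecified.\<close>

lemma concurrence_greatest:
  assumes "ensemble (insert a Y) \<rho> I w"
    and "\<And>n p \<psi>. pure_decomposition (insert a Y) \<rho> n p \<psi> \<Longrightarrow>
      r \<le> (\<Sum>i<n. p i * pure_concurrence (insert a Y) {a} (\<psi> i))"
  shows "r \<le> concurrence (insert a Y) {a} \<rho>"
proof -
  obtain n p \<psi> where "pure_decomposition (insert a Y) \<rho> n p \<psi>"
    using ensemble_imp_pure_decomposition [OF Y assms(1) tr] .
  then show ?thesis unfolding concurrence_def
    by (intro cInf_greatest) (use assms(2) in auto)
qed

lemma concurrence_nonneg: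
  assumes "ensemble (insert a Y) \<rho> I w"
  shows "0 \<le> concurrence (insert a Y) {a} \<rho>"
  using concurrence_greatest [OF assms] pure_decomposition_concurrence_nonneg by blast

end

section \<open>Monogamy of the concurrence\<close>

text \<open>The qubit state with a given Bloch vector. Its first amplitude can be taken as the real
  root of \<open>(1 + x) / 2\<close>; the second is found by dividing by it, so
  \<open>x = -1\<close> is separate.\<close>

lemma unit_bloch_vector:
  fixes x :: real and y :: complex
  assumes "x\<^sup>2 + (cmod y)\<^sup>2 = 1"
  obtains \<alpha> \<beta> :: complex where "\<alpha> * cnj \<alpha> + \<beta> * cnj \<beta> = 1" "\<alpha> * cnj \<alpha> - \<beta> * cnj \<beta> = of_real x" "2 * cnj \<alpha> * \<beta> = y"
proof (cases "x = -1")
  case True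
  then have "y = 0" using assms by simp
  then show ?thesis using that [of 0 1] True by simp
next
  case False
  have "x\<^sup>2 \<le> 1" using assms by (metis le_add_same_cancel1 zero_le_power2)
  then have "-1 \<le> x" by (simp add: abs_square_le_1)
  with False have x: "0 < 1 + x" by simp
  define r where "r = sqrt ((1 + x) / 2)"
  have r: "r > 0" "r * r = (1 + x) / 2" using x by (simp_all add: r_def)
  define \<beta> where "\<beta> = y / of_real (2 * r)"
  have "(cmod y)\<^sup>2 = (1 + x) * (1 - x)" using assms by (simp add: algebra_simps power2_eq_square)
  then have "y * cnj y = of_real ((1 + x) * (1 - x))" by (simp only: flip: complex_norm_square)
  then have "\<beta> * cnj \<beta> = of_real ((1 + x) * (1 - x)) / of_real (4 * (r * r))"
    by (simp add: \<beta>_def)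
  also have "\<dots> = of_real ((1 + x) * (1 - x) / (4 * (r * r)))" by (simp only: of_real_divide)
  also have "(1 + x) * (1 - x) / (4 * (r * r)) = (1 - x) / 2"
    unfolding r(2) using x by (simp add: field_simps)
  finally have b: "\<beta> * cnj \<beta> = of_real ((1 - x) / 2)" .
  have a: "complex_of_real r * cnj (of_real r) = of_real ((1 + x) / 2)"
    unfolding r(2) [symmetric] by simp
  show ?thesis
  proof (rule that [of "of_real r" \<beta>])
    show "of_real r * cnj (of_real r) + \<beta> * cnj \<beta> = 1"
      unfolding a b of_real_add [symmetric] by (simp add: field_simps)
    show "of_real r * cnj (of_real r) - \<beta> * cnj \<beta> = of_real x"
      unfolding a b of_real_diff [symmetric] by (simp add: field_simps)
    show "2 * cnj (of_real r) * \<beta> = y" using r by (simp add: \<beta>_def)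
  qed
qed

text \<open>
  Tracing out \<open>Y\<close> leaves a two-qubit matrix \<open>R\<close>. The Hermitian matrix provided by
  \<open>two_qubit_ensemble\<close> is the difference of the projections onto an orthonormal basis of
  the qubit \<open>b\<close>; measuring \<open>b\<close> in this basis decomposes the state of the remaining qubits.
\<close>

lemma pure_monogamy:
  fixes \<psi> :: "'q set cvec"
  assumes "finite Y" "a \<notin> Y" "b \<notin> Y" "a \<noteq> b"
  defines "S \<equiv> insert a (insert b Y)"
  obtains Z :: "4 \<Rightarrow> 'q set cvec" and \<xi> :: "bool \<Rightarrow> 'q set cvec"
  where "ensemble {a, b} (reduced S {a, b} (ketbra \<psi>)) UNIV Z"
    and "ensemble (insert a Y) (reduced S (insert a Y) (ketbra \<psi>)) UNIV \<xi>"
    and "(\<Sum>c\<in>UNIV. vconc {b} a (Z c))\<^sup>2 + (\<Sum>c\<in>UNIV. vconc Y a (\<xi> c))\<^sup>2 \<le> (vconc (insert b Y) a \<psi>)\<^sup>2"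
proof -
  \<comment> \<open>The basis labels of \<open>a\<close> and \<open>b\<close> in the order of the
    coordinates of \<open>qdet\<close>, with \<open>a\<close> as first qubit.\<close>
  define B :: "4 \<Rightarrow> 'q set" where "B i = (if i = 1 then {} else if i = 2 then {b} else if i = 3 then {a} else {a, b})" for i
  have B: "B 1 = {}" "B 2 = {b}" "B 3 = {a}" "B 4 = {a, b}" by (simp_all add: B_def)
  define f where "f i z = \<psi> (B i \<union> z)" for i z
  have f: "f 1 z = \<psi> z" "f 2 z = \<psi> (insert b z)" "f 3 z = \<psi> (insert a z)" "f 4 z = \<psi> (insert a (insert b z))" for z
    by (simp_all add: f_def B)
  define R :: "complex^4^4" where "R = (\<chi> i j. ip Y (f i) (f j))"
  have R: "R $ i $ j = ip Y (f i) (f j)" for i j by (simp add: R_def)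
  have "pos_semidef UNIV (\<lambda>i j. R $ i $ j)"
    unfolding pos_semidef_def
  proof (intro conjI ballI allI)
    show "R $ j $ i = cnj (R $ i $ j)" for i j by (simp add: R cnj_ip)
    fix v :: "4 \<Rightarrow> complex"
    have "(\<Sum>i\<in>UNIV. \<Sum>j\<in>UNIV. cnj (v i) * R $ i $ j * v j) =
        (\<Sum>z\<in>Pow Y. (\<Sum>i\<in>UNIV. cnj (v i) * f i z) * cnj (\<Sum>j\<in>UNIV. cnj (v j) * f j z))"
    proof -
      define g where "g i z = cnj (v i) * f i z" for i z
      have "cnj (v i) * R $ i $ j * v j = (\<Sum>z\<in>Pow Y. g i z * cnj (g j z))" for i j
        unfolding R ip_def g_def by (simp add: sum_distrib_left sum_distrib_right mult_ac)
      then have "(\<Sum>i\<in>UNIV. \<Sum>j\<in>UNIV. cnj (v i) * R $ i $ j * v j) =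
          (\<Sum>i\<in>UNIV. \<Sum>j\<in>UNIV. \<Sum>z\<in>Pow Y. g i z * cnj (g j z))"
        by (simp only:)
      also have "\<dots> = (\<Sum>i\<in>UNIV. \<Sum>z\<in>Pow Y. \<Sum>j\<in>UNIV. g i z * cnj (g j z))"
        by (intro sum.cong sum.swap refl)
      also have "\<dots> = (\<Sum>z\<in>Pow Y. \<Sum>i\<in>UNIV. \<Sum>j\<in>UNIV. g i z * cnj (g j z))"
        by (rule sum.swap)
      finally show ?thesis unfolding g_def by (simp only: sum_product cnj_sum)
    qed
    also have "\<dots> = of_real (\<Sum>z\<in>Pow Y. (cmod (\<Sum>i\<in>UNIV. cnj (v i) * f i z))\<^sup>2)"
      by (simp only: of_real_sum complex_norm_square)
    finally show "0 \<le> Re (\<Sum>i\<in>UNIV. \<Sum>j\<in>UNIV. cnj (v i) * R $ i $ j * v j)"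
      by (simp add: sum_nonneg)
  qed
  then obtain V :: "complex^4^4" and x y where V: "gram V = R" and xy: "x\<^sup>2 + (cmod y)\<^sup>2 = 1"
    and le: "(\<Sum>c\<in>UNIV. cmod (qdet (V $ c)))\<^sup>2 \<le> hdet R x y"
    by (rule two_qubit_ensemble)
  define Z :: "4 \<Rightarrow> 'q set cvec"
    where "Z c X = V $ c $ (if X = {} then 1 else if X = {b} then 2 else if X = {a} then 3 else 4)" for c X
  have "\<forall>i. Z c (B i) = V $ c $ i" for c
    unfolding forall_4 B using assms(4) by (simp add: Z_def doubleton_eq_iff)
  then have ZB: "Z c (B i) = V $ c $ i" for c i by blast
  have Pow_ab: "\<exists>i. X = B i" if "X \<in> Pow {a, b}" for X
  proof -
    have "X \<in> B ` {1, 2, 3, 4}" using that by (auto simp: B Pow_insert)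
    then show ?thesis by blast
  qed
  have Sab: "S - {a, b} = Y" "S - insert a Y = {b}" using assms(2-4) by (auto simp: S_def)
  have "ensemble {a, b} (reduced S {a, b} (ketbra \<psi>)) UNIV Z"
    unfolding ensemble_def
  proof (intro conjI ballI)
    fix X X' assume "X \<in> Pow {a, b}" "X' \<in> Pow {a, b}"
    then obtain i j where X: "X = B i" "X' = B j" using Pow_ab [of X] Pow_ab [of X'] by blast
    have "reduced S {a, b} (ketbra \<psi>) X X' = gram V $ i $ j"
      unfolding V R X reduced_def Sab ip_def by (simp add: ketbra_def f_def)
    then show "reduced S {a, b} (ketbra \<psi>) X X' = (\<Sum>c\<in>UNIV. Z c X * cnj (Z c X'))"
      unfolding X ZB gram_nth .
  qed simp
  moreover have "vconc {b} a (Z c) = 2 * cmod (qdet (V $ c))" for c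
  proof -
    have ip: "ip {b} g h = g {} * cnj (h {}) + g {b} * cnj (h {b})" for g h :: "'q set cvec"
      by (simp add: ip_def Pow_insert add.commute)
    have Zs: "Z c {} = V $ c $ 1" "Z c {b} = V $ c $ 2" "Z c {a} = V $ c $ 3" "Z c {a, b} = V $ c $ 4"
      using ZB [of c 1] ZB [of c 2] ZB [of c 3] ZB [of c 4] by (simp_all add: B)
    have re: "of_real (Re (u * cnj u + v * cnj v)) = u * cnj u + v * cnj v" for u v
      by (simp add: complex_eq_iff)
    have "complex_of_real (vdet {b} a (Z c)) = of_real ((cmod (qdet (V $ c)))\<^sup>2)"
      unfolding vdet_def ip of_real_diff of_real_mult re complex_norm_square Zs qdet_def
      by (simp add: algebra_simps)
    then have "vdet {b} a (Z c) = (cmod (qdet (V $ c)))\<^sup>2"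
      using of_real_eq_iff by blast
    then show ?thesis by (simp add: vconc_def)
  qed
  then have "(\<Sum>c\<in>UNIV. vconc {b} a (Z c))\<^sup>2 \<le> 4 * hdet R x y"
    using le by (simp add: power_mult_distrib flip: sum_distrib_left)
  moreover
  obtain \<alpha> \<beta> :: complex where ab: "\<alpha> * cnj \<alpha> + \<beta> * cnj \<beta> = 1"
    and abx: "\<alpha> * cnj \<alpha> - \<beta> * cnj \<beta> = of_real x" and aby: "2 * cnj \<alpha> * \<beta> = y"
    using unit_bloch_vector [OF xy] .
  \<comment> \<open>The unnormalised states left by measuring \<open>b\<close> in the basis
    \<open>(\<alpha>, \<beta>)\<close>, \<open>(- cnj \<beta>, cnj \<alpha>)\<close>.\<close>
  define \<xi> where "\<xi> t X = (if t then cnj \<alpha> * \<psi> X + cnj \<beta> * \<psi> (insert b X) else (-\<beta>) * \<psi> X + \<alpha> * \<psi> (insert b X))"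
    for t :: bool and X
  have "ensemble (insert a Y) (reduced S (insert a Y) (ketbra \<psi>)) UNIV \<xi>"
    unfolding ensemble_def
  proof (intro conjI ballI)
    fix X X'
    have "(\<Sum>t\<in>UNIV. \<xi> t X * cnj (\<xi> t X')) =
      (\<alpha> * cnj \<alpha> + \<beta> * cnj \<beta>) * (\<psi> X * cnj (\<psi> X') + \<psi> (insert b X) * cnj (\<psi> (insert b X')))"
      by (simp add: UNIV_bool \<xi>_def algebra_simps)
    then show "reduced S (insert a Y) (ketbra \<psi>) X X' = (\<Sum>t\<in>UNIV. \<xi> t X * cnj (\<xi> t X'))"
      unfolding ab reduced_def Sab by (simp add: ketbra_def Pow_insert add.commute)
  qed simp
  moreover
  have "(\<Sum>t\<in>UNIV. vconc Y a (\<xi> t))\<^sup>2 \<le> 4 * vdet (insert b Y) a \<psi> - 4 * hdet R x y"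
  proof -
    define p q where "p i j = ip Y (\<lambda>z. \<xi> True (B i \<union> z)) (\<lambda>z. \<xi> True (B j \<union> z))"
      and "q i j = ip Y (\<lambda>z. \<xi> False (B i \<union> z)) (\<lambda>z. \<xi> False (B j \<union> z))" for i j
    have vd: "vdet Y a (\<xi> True) = Re (p 1 1) * Re (p 3 3) - (cmod (p 1 3))\<^sup>2"
       "vdet Y a (\<xi> False) = Re (q 1 1) * Re (q 3 3) - (cmod (q 1 3))\<^sup>2"
      by (simp_all add: vdet_def p_def q_def B)
    have shift: "\<xi> True (B i \<union> z) = cnj \<alpha> * f i z + cnj \<beta> * f i' z"
       "\<xi> False (B i \<union> z) = (-\<beta>) * f i z + \<alpha> * f i' z"
      if "B i' = insert b (B i)" for i i' z
      by (simp_all add: \<xi>_def f_def that)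
    have B': "B 2 = insert b (B 1)" "B 4 = insert b (B 3)" by (auto simp: B)
    \<comment> \<open>The marginals of the two outcomes add up to that of \<open>\<psi>\<close>, and
      their difference is the matrix whose determinant is minus \<open>hdet\<close>.\<close>
    have pq: "p i j + q i j = R $ i $ j + R $ i' $ j'" "p i j - q i j = hmat R x y i i' j j'"
      if "B i' = insert b (B i)" "B j' = insert b (B j)" for i i' j j'
    proof -
      have p: "p i j = cnj \<alpha> * \<alpha> * R $ i $ j + cnj \<alpha> * \<beta> * R $ i $ j' + cnj \<beta> * \<alpha> * R $ i' $ j + cnj \<beta> * \<beta> * R $ i' $ j'"
        unfolding p_def shift [OF that(1)] shift [OF that(2)] ip_comb R by simp
      have q: "q i j = \<beta> * cnj \<beta> * R $ i $ j - \<beta> * cnj \<alpha> * R $ i $ j' - \<alpha> * cnj \<beta> * R $ i' $ j + \<alpha> * cnj \<alpha> * R $ i' $ j'"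
        unfolding q_def shift [OF that(1)] shift [OF that(2)] ip_comb R by simp
      have "p i j + q i j = (\<alpha> * cnj \<alpha> + \<beta> * cnj \<beta>) * (R $ i $ j + R $ i' $ j')"
        unfolding p q by (simp add: algebra_simps)
      then show "p i j + q i j = R $ i $ j + R $ i' $ j'" using ab by simp
      show "p i j - q i j = hmat R x y i i' j j'"
        unfolding p q hmat_def abx [symmetric] aby [symmetric] by (simp add: algebra_simps)
    qed
    have ipb: "ip (insert b Y) g h = ip Y g h + ip Y (\<lambda>z. g (insert b z)) (\<lambda>z. h (insert b z))" for g h
      using assms by (intro ip_insert) auto
    have vp: "vdet (insert b Y) a \<psi> = Re (p 1 1 + q 1 1) * Re (p 3 3 + q 3 3) - (cmod (p 1 3 + q 1 3))\<^sup>2"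
      unfolding pq(1) [OF B'(1) B'(1)] pq(1) [OF B'(1) B'(2)] pq(1) [OF B'(2) B'(2)] R vdet_def ipb
      by (simp add: f [abs_def] insert_commute)
    have hd: "hdet R x y = (cmod (p 1 3 - q 1 3))\<^sup>2 - Re (p 1 1 - q 1 1) * Re (p 3 3 - q 3 3)"
      unfolding pq(2) [OF B'(1) B'(1)] pq(2) [OF B'(1) B'(2)] pq(2) [OF B'(2) B'(2)] hdet_def ..
    \<comment> \<open>The parallelogram identity of the determinant, a quadratic form on two-by-two
      matrices.\<close>
    have sum: "vdet (insert b Y) a \<psi> - hdet R x y = 2 * vdet Y a (\<xi> True) + 2 * vdet Y a (\<xi> False)"
      unfolding vp hd vd by (simp add: cmod_power2) (simp add: power2_eq_square algebra_simps)
    have sq: "(2 * sqrt u + 2 * sqrt v)\<^sup>2 \<le> 8 * u + 8 * v" if "0 \<le> u" "0 \<le> v" for u v :: real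
    proof -
      have "0 \<le> (2 * sqrt u - 2 * sqrt v)\<^sup>2" by simp
      then show ?thesis using that by (simp add: power2_sum power2_diff)
    qed
    have "(\<Sum>t\<in>UNIV. vconc Y a (\<xi> t))\<^sup>2 \<le> 8 * vdet Y a (\<xi> True) + 8 * vdet Y a (\<xi> False)"
      using sq [OF vdet_nonneg vdet_nonneg] by (simp add: UNIV_bool vconc_def add.commute)
    then show ?thesis using sum by simp
  qed
  moreover have "(vconc (insert b Y) a \<psi>)\<^sup>2 = 4 * vdet (insert b Y) a \<psi>"
    by (simp add: vconc_def power_mult_distrib vdet_nonneg)
  ultimately show ?thesis using that [of Z \<xi>] by simp
qed

text \<open>Ensembles of the components, scaled by the roots of the probabilities, together form an
  ensemble of the mixture.\<close>

lemma sum_ketbra_ensemble: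
  fixes w :: "nat \<Rightarrow> 'i::finite \<Rightarrow> 'q set cvec"
  assumes S: "T \<subseteq> S" and dec: "pure_decomposition S \<rho> n p \<psi>"
    and ens: "\<And>i. ensemble T (reduced S T (ketbra (\<psi> i))) UNIV (w i)"
  shows "ensemble T (reduced S T \<rho>) ({..<n} \<times> UNIV) (\<lambda>q x. of_real (sqrt (p (fst q))) * w (fst q) (snd q) x)"
  unfolding ensemble_def
proof (intro conjI ballI)
  fix x y assume xy: "x \<in> Pow T" "y \<in> Pow T"
  have "reduced S T \<rho> x y = (\<Sum>z\<in>Pow (S - T). \<Sum>i<n. of_real (p i) * ketbra (\<psi> i) (x \<union> z) (y \<union> z))"
    unfolding reduced_def
  proof (intro sum.cong refl)
    fix z assume "z \<in> Pow (S - T)"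
    then have "x \<union> z \<in> Pow S" "y \<union> z \<in> Pow S" using xy S by auto
    then show "\<rho> (x \<union> z) (y \<union> z) = (\<Sum>i<n. of_real (p i) * ketbra (\<psi> i) (x \<union> z) (y \<union> z))"
      using dec unfolding pure_decomposition_def by blast
  qed
  also have "\<dots> = (\<Sum>i<n. of_real (p i) * reduced S T (ketbra (\<psi> i)) x y)"
    unfolding reduced_def by (subst sum.swap) (simp only: sum_distrib_left)
  also have "\<dots> = (\<Sum>i<n. \<Sum>c\<in>UNIV. (of_real (sqrt (p i)) * w i c x) * cnj (of_real (sqrt (p i)) * w i c y))"
  proof (intro sum.cong refl)
    fix i assume "i \<in> {..<n}"
    then have "0 \<le> p i" using dec by (simp add: pure_decomposition_def)
    then have p: "complex_of_real (p i) = of_real (sqrt (p i)) * of_real (sqrt (p i))"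
      by (simp flip: of_real_mult)
    have "reduced S T (ketbra (\<psi> i)) x y = (\<Sum>c\<in>UNIV. w i c x * cnj (w i c y))"
      using ens [of i] xy unfolding ensemble_def by blast
    then show "of_real (p i) * reduced S T (ketbra (\<psi> i)) x y =
      (\<Sum>c\<in>UNIV. (of_real (sqrt (p i)) * w i c x) * cnj (of_real (sqrt (p i)) * w i c y))"
      unfolding p by (simp add: sum_distrib_left mult_ac)
  qed
  finally show "reduced S T \<rho> x y = (\<Sum>q\<in>{..<n} \<times> UNIV. of_real (sqrt (p (fst q))) * w (fst q) (snd q) x
      * cnj (of_real (sqrt (p (fst q))) * w (fst q) (snd q) y))"
    by (simp add: sum.cartesian_product case_prod_unfold)
qed simp

lemma concurrence_reduced_le:
  fixes w :: "nat \<Rightarrow> 'i::finite \<Rightarrow> 'q set cvec"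
  assumes S: "finite S" "insert a Y \<subseteq> S" "a \<notin> Y" and tr: "mtrace (Pow S) \<rho> = 1"
    and dec: "pure_decomposition S \<rho> n p \<psi>"
    and ens: "\<And>i. ensemble (insert a Y) (reduced S (insert a Y) (ketbra (\<psi> i))) UNIV (w i)"
  shows "concurrence (insert a Y) {a} (reduced S (insert a Y) \<rho>) \<le> (\<Sum>i<n. p i * (\<Sum>c\<in>UNIV. vconc Y a (w i c)))"
proof -
  have "finite Y" using S finite_subset by auto
  have "concurrence (insert a Y) {a} (reduced S (insert a Y) \<rho>) \<le>
    (\<Sum>q\<in>{..<n} \<times> (UNIV :: 'i set). vconc Y a (\<lambda>x. of_real (sqrt (p (fst q))) * w (fst q) (snd q) x))"
    using \<open>finite Y\<close> S tr by (intro concurrence_le sum_ketbra_ensemble [OF S(2) dec ens]) (simp_all add: mtrace_reduced)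
  also have "\<dots> = (\<Sum>i<n. \<Sum>c\<in>UNIV. vconc Y a (\<lambda>x. of_real (sqrt (p i)) * w i c x))"
    by (simp add: sum.cartesian_product case_prod_unfold)
  also have "\<dots> = (\<Sum>i<n. p i * (\<Sum>c\<in>UNIV. vconc Y a (w i c)))"
    unfolding sum_distrib_left
    using dec by (intro sum.cong refl) (simp add: vconc_smult pure_decomposition_def)
  finally show ?thesis .
qed

theorem concurrence_monogamy:
  fixes \<rho> :: "'q set cmat"
  assumes Y: "finite Y" "a \<notin> Y" "b \<notin> Y" "a \<noteq> b"
  defines "S \<equiv> insert a (insert b Y)"
  assumes ens: "ensemble S \<rho> I w" and tr: "mtrace (Pow S) \<rho> = 1"
  shows "(concurrence {a, b} {a} (reduced S {a, b} \<rho>))\<^sup>2 +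
    (concurrence (insert a Y) {a} (reduced S (insert a Y) \<rho>))\<^sup>2 \<le> (concurrence S {a} \<rho>)\<^sup>2"
proof -
  define c1 c2 where "c1 = concurrence {a, b} {a} (reduced S {a, b} \<rho>)"
    and "c2 = concurrence (insert a Y) {a} (reduced S (insert a Y) \<rho>)"
  have S: "finite S" "{a, b} \<subseteq> S" "insert a Y \<subseteq> S" using Y by (auto simp: S_def)
  have "0 \<le> c1" unfolding c1_def
    using Y ensemble_reduced [OF S(1,2) ens] tr
    by (intro concurrence_nonneg) (simp_all add: mtrace_reduced [OF S(1,2)])
  have "0 \<le> c2" unfolding c2_def
    using Y ensemble_reduced [OF S(1,3) ens] tr
    by (intro concurrence_nonneg) (simp_all add: mtrace_reduced [OF S(1,3)])
  have "sqrt (c1\<^sup>2 + c2\<^sup>2) \<le> concurrence S {a} \<rho>"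
    unfolding S_def
  proof (rule concurrence_greatest [OF _ _ tr [unfolded S_def] ens [unfolded S_def]])
    show "finite (insert b Y)" "a \<notin> insert b Y" using Y by auto
    fix n p \<psi> assume "pure_decomposition (insert a (insert b Y)) \<rho> n p \<psi>"
    then have dec: "pure_decomposition S \<rho> n p \<psi>" by (simp add: S_def)
    have "\<exists>Z \<xi>. ensemble {a, b} (reduced S {a, b} (ketbra (\<psi> i))) (UNIV :: 4 set) Z
      \<and> ensemble (insert a Y) (reduced S (insert a Y) (ketbra (\<psi> i))) (UNIV :: bool set) \<xi>
      \<and> (\<Sum>c\<in>UNIV. vconc {b} a (Z c))\<^sup>2 + (\<Sum>c\<in>UNIV. vconc Y a (\<xi> c))\<^sup>2 \<le> (vconc (insert b Y) a (\<psi> i))\<^sup>2" for i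
      using pure_monogamy [OF Y, of "\<psi> i"] unfolding S_def by metis
    then obtain Z \<xi> where Z: "\<And>i. ensemble {a, b} (reduced S {a, b} (ketbra (\<psi> i))) (UNIV :: 4 set) (Z i)"
      and \<xi>: "\<And>i. ensemble (insert a Y) (reduced S (insert a Y) (ketbra (\<psi> i))) (UNIV :: bool set) (\<xi> i)"
      and le: "\<And>i. (\<Sum>c\<in>UNIV. vconc {b} a (Z i c))\<^sup>2 + (\<Sum>c\<in>UNIV. vconc Y a (\<xi> i c))\<^sup>2 \<le> (vconc (insert b Y) a (\<psi> i))\<^sup>2"
      by metis
    define r s where "r i = (\<Sum>c\<in>UNIV. vconc {b} a (Z i c))" and "s i = (\<Sum>c\<in>UNIV. vconc Y a (\<xi> i c))" for i
    have "c1 \<le> (\<Sum>i<n. p i * r i)" unfolding c1_def r_def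
      using S Y by (intro concurrence_reduced_le [OF S(1) _ _ tr dec Z]) auto
    moreover have "c2 \<le> (\<Sum>i<n. p i * s i)" unfolding c2_def s_def
      using S Y by (intro concurrence_reduced_le [OF S(1) _ _ tr dec \<xi>]) auto
    ultimately have "c1\<^sup>2 + c2\<^sup>2 \<le> (\<Sum>i<n. p i * r i)\<^sup>2 + (\<Sum>i<n. p i * s i)\<^sup>2"
      using \<open>0 \<le> c1\<close> \<open>0 \<le> c2\<close> by (intro add_mono power_mono)
    then have "sqrt (c1\<^sup>2 + c2\<^sup>2) \<le> sqrt ((\<Sum>i<n. p i * r i)\<^sup>2 + (\<Sum>i<n. p i * s i)\<^sup>2)"
      by simp
    \<comment> \<open>Both averages are coordinates of one average of points in the plane, whose
      moduli are bounded by the pure case.\<close>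
    also have "\<dots> = cmod (\<Sum>i<n. of_real (p i) * Complex (r i) (s i))"
      by (simp add: cmod_def)
    also have "\<dots> \<le> (\<Sum>i<n. p i * vconc (insert b Y) a (\<psi> i))"
    proof (rule sum_norm_le)
      fix i assume "i \<in> {..<n}"
      then have "0 \<le> p i" using dec by (simp add: pure_decomposition_def)
      moreover have "cmod (Complex (r i) (s i)) \<le> vconc (insert b Y) a (\<psi> i)"
        unfolding complex_norm using le [of i] by (intro real_le_lsqrt) (simp_all add: r_def s_def vconc_nonneg)
      ultimately show "cmod (of_real (p i) * Complex (r i) (s i)) \<le> p i * vconc (insert b Y) a (\<psi> i)"
        by (simp add: norm_mult mult_left_mono)
    qed
    also have "\<dots> = (\<Sum>i<n. p i * pure_concurrence (insert a (insert b Y)) {a} (\<psi> i))"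
      using dec Y by (intro sum.cong refl) (simp add: pure_concurrence_eq_vconc pure_decomposition_def S_def)
    finally show "sqrt (c1\<^sup>2 + c2\<^sup>2) \<le> (\<Sum>i<n. p i * pure_concurrence (insert a (insert b Y)) {a} (\<psi> i))" .
  qed
  then show ?thesis
    unfolding c1_def [symmetric] c2_def [symmetric] by (rule sqrt_le_D)
qed

section \<open>The power inequality\<close>

text \<open>Up to a positive factor the derivative is
  \<open>1 + s powr (2 * x) - (1 + s) powr (x - 1)\<close>. For \<open>s \<le> 1\<close> and
  \<open>2 \<le> x\<close> the first two terms are at most \<open>1 + s\<close>, hence at most the
  last power; this is where \<open>4 \<le> \<beta>\<close> enters.\<close>

lemma powr_ratio_antimono:
  fixes x t k :: real
  assumes x: "2 \<le> x" and t: "0 < t" "t \<le> k" and k: "k \<le> 1"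
  shows "((1 + k) powr x - 1) / k powr x + k powr x \<le> ((1 + t) powr x - 1) / t powr x + t powr x"
proof (rule DERIV_nonpos_imp_nonincreasing [OF t(2)])
  fix s assume s: "t \<le> s" "s \<le> k"
  with t k have s0: "0 < s" "s \<le> 1" by auto
  let ?D = "x * ((1 + s) powr (x - 1) * s powr x - ((1 + s) powr x - 1) * s powr (x - 1)) / (s powr x)\<^sup>2
      + x * s powr (x - 1)"
  have "((\<lambda>s. ((1 + s) powr x - 1) / s powr x + s powr x) has_real_derivative ?D) (at s)"
    using s0 by (auto intro!: derivative_eq_intros simp: field_simps power2_eq_square powr_diff)
  moreover have "?D \<le> 0"
  proof -
    have a: "(1 + s) powr x = (1 + s) * (1 + s) powr (x - 1)"
      using s0 by (simp add: powr_diff)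
    have b: "s powr x = s * s powr (x - 1)"
      using s0 by (simp add: powr_diff)
    have "1 + s powr x * s powr x \<le> 1 + s"
    proof -
      have "s powr x * s powr x = s powr (2 * x)" by (simp flip: powr_add)
      also have "\<dots> \<le> s powr 1" using s0 x by (intro powr_mono') auto
      finally show ?thesis using s0 by simp
    qed
    also have "\<dots> \<le> (1 + s) powr (x - 1)"
      using powr_mono [of 1 "x - 1" "1 + s"] s0 x by simp
    finally have c: "1 + s powr x * s powr x - (1 + s) powr (x - 1) \<le> 0" by simp
    have d: "?D = x * s powr (x - 1) / (s powr x)\<^sup>2 * (1 + s powr x * s powr x - (1 + s) powr (x - 1))"
      using s0 unfolding a by (simp add: field_simps power2_eq_square b)
    show ?thesis unfolding d using c x s0 by (intro mult_nonneg_nonpos) auto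
  qed
  ultimately show "\<exists>y. ((\<lambda>s. ((1 + s) powr x - 1) / s powr x + s powr x) has_real_derivative y) (at s) \<and> y \<le> 0"
    by blast
qed

text \<open>With \<open>M_const\<close> taken at the actual ratio \<open>t\<close> of the squares
  instead of \<open>k\<close>, the bound would be the identity for \<open>(1 + t) powr x\<close>,
  scaled by \<open>c powr \<beta>\<close>. Since \<open>t \<le> k\<close>, the constant at
  \<open>k\<close> is no larger.\<close>

lemma monogamy_power_step:
  fixes k \<beta> c d e :: real
  assumes k: "0 < k" "k \<le> 1" and \<beta>: "4 \<le> \<beta>"
    and nn: "0 \<le> c" "0 \<le> d" "0 \<le> e"
    and mono: "c\<^sup>2 + d\<^sup>2 \<le> e\<^sup>2" and ord: "d\<^sup>2 \<le> k * c\<^sup>2"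
  shows "c powr \<beta> + (M_const k \<beta> - d powr \<beta> / c powr \<beta>) * d powr \<beta> \<le> e powr \<beta>"
    and "0 \<le> M_const k \<beta> - d powr \<beta> / c powr \<beta>"
proof -
  define x where "x = \<beta> / 2"
  have x: "2 \<le> x" using \<beta> by (simp add: x_def)
  have pw: "u powr \<beta> = (u\<^sup>2) powr x" if "0 \<le> u" for u :: real
    using that by (cases "u = 0") (auto simp: x_def powr_powr simp flip: powr_numeral)
  have kx: "((1 + k) powr x - 1) / k powr x \<ge> 0"
    using k x by (intro divide_nonneg_nonneg) (auto simp: ge_one_powr_ge_zero)
  define t where "t = d\<^sup>2 / c\<^sup>2"
  \<comment> \<open>This includes \<open>c = 0\<close>, where both quotients are 0 by convention and
    \<open>0 powr x\<close> is 0.\<close>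
  have tx: "d powr \<beta> / c powr \<beta> = t powr x"
    unfolding t_def using nn by (simp add: pw powr_divide)
  have tk: "0 \<le> t" "t \<le> k"
    using ord k by (auto simp: t_def divide_simps split: if_splits)
  have "t powr x \<le> k powr x" using tk x by (intro powr_mono2) auto
  then show "0 \<le> M_const k \<beta> - d powr \<beta> / c powr \<beta>"
    unfolding tx M_const_def using kx by (simp add: x_def)
  have M: "M_const k \<beta> = ((1 + k) powr x - 1) / k powr x + k powr x"
    by (simp add: M_const_def x_def)
  show "c powr \<beta> + (M_const k \<beta> - d powr \<beta> / c powr \<beta>) * d powr \<beta> \<le> e powr \<beta>"
  proof (cases "d = 0")
    case True
    then have "c powr \<beta> \<le> e powr \<beta>"
      using mono nn \<beta> by (intro powr_mono2) (auto intro: power2_le_imp_le)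
    then show ?thesis using True by simp
  next
    case False
    then have c: "0 < c" using nn ord k by (cases "c = 0") auto
    have t0: "0 < t" using False c by (simp add: t_def)
    have "M_const k \<beta> \<le> ((1 + t) powr x - 1) / t powr x + t powr x"
      unfolding M using powr_ratio_antimono [OF x t0 tk(2) k(2)] .
    then have "(M_const k \<beta> - t powr x) * t powr x \<le> ((1 + t) powr x - 1) / t powr x * t powr x"
      by (intro mult_right_mono) auto
    then have "1 + (M_const k \<beta> - t powr x) * t powr x \<le> (1 + t) powr x"
      using t0 by simp
    then have "(c\<^sup>2) powr x * (1 + (M_const k \<beta> - t powr x) * t powr x) \<le> (c\<^sup>2) powr x * (1 + t) powr x"
      by (intro mult_left_mono) auto
    also have "\<dots> = (c\<^sup>2 * (1 + t)) powr x"
      using t0 by (simp add: powr_mult)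
    also have "c\<^sup>2 * (1 + t) = c\<^sup>2 + d\<^sup>2"
      using c by (simp add: t_def field_simps)
    also have "(c\<^sup>2 + d\<^sup>2) powr x \<le> (e\<^sup>2) powr x"
      using mono x by (intro powr_mono2) auto
    finally have main: "(c\<^sup>2) powr x * (1 + (M_const k \<beta> - t powr x) * t powr x) \<le> (e\<^sup>2) powr x" .
    have "d\<^sup>2 = c\<^sup>2 * t" using c by (simp add: t_def)
    then have "d powr \<beta> = (c\<^sup>2) powr x * t powr x"
      using nn t0 by (simp add: pw powr_mult)
    then show ?thesis using main nn unfolding tx by (simp add: pw algebra_simps)
  qed
qed

text \<open>The step is iterated on the remainder \<open>d\<close>, multiplied by the nonnegative
  factors collected so far; at \<open>m\<close> the remainder is bounded below by
  \<open>c m\<close>.\<close>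

lemma monogamy_chain:
  fixes c d M :: "nat \<Rightarrow> real"
  assumes step: "\<And>i. \<lbrakk>1 \<le> i; i < m\<rbrakk> \<Longrightarrow> c i + M i * d (Suc i) \<le> d i"
    and M: "\<And>i. \<lbrakk>1 \<le> i; i < m\<rbrakk> \<Longrightarrow> 0 \<le> M i"
    and last: "c m \<le> d m" and m: "1 \<le> m"
  shows "c 1 + (\<Sum>i = 1..m - 1. (\<Prod>j = 1..i. M j) * c (i + 1)) \<le> d 1"
proof -
  \<comment> \<open>The sum stops before \<open>n\<close>, since the term with
    \<open>c (n + 1)\<close> is still contained in the remainder \<open>d (Suc n)\<close>.\<close>
  have "c 1 + (\<Sum>i = 1..<n. (\<Prod>j = 1..i. M j) * c (i + 1)) + (\<Prod>j = 1..n. M j) * d (Suc n) \<le> d 1"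
    if "1 \<le> n" "n < m" for n using that
  proof (induction n rule: nat_induct_at_least)
    case base
    then show ?case using step [of 1] by simp
  next
    case (Suc n)
    have "(\<Prod>j = 1..n. M j) * (c (Suc n) + M (Suc n) * d (Suc (Suc n))) \<le> (\<Prod>j = 1..n. M j) * d (Suc n)"
      using Suc by (intro mult_left_mono step prod_nonneg M) auto
    then show ?case using Suc by (simp add: algebra_simps)
  qed
  note * = this
  show ?thesis
  proof (cases "m = 1")
    case True
    then show ?thesis using last by simp
  next
    case False
    then obtain n where n: "m = Suc n" "1 \<le> n" using m by (cases m) auto
    have "(\<Prod>j = 1..n. M j) * c (Suc n) \<le> (\<Prod>j = 1..n. M j) * d (Suc n)"
      using last n by (intro mult_left_mono prod_nonneg M) auto
    moreover have "{1..n} = insert n {1..<n}" using n by auto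
    ultimately show ?thesis using *[of n] n by (simp add: atLeastLessThanSuc)
  qed
qed

section \<open>Application to the qubit A and the remaining chain\<close>

lemma conc_A_monogamy:
  assumes "2 \<le> N" and \<rho>: "mixed_state {..<N} \<rho>" and i: "1 \<le> i"
  shows "0 \<le> conc_A_from N \<rho> i" and "i < N \<Longrightarrow> 0 \<le> conc_AB N \<rho> i"
    and "i < N \<Longrightarrow> (conc_AB N \<rho> i)\<^sup>2 + (conc_A_from N \<rho> (i + 1))\<^sup>2 \<le> (conc_A_from N \<rho> i)\<^sup>2"
proof -
  have tr: "mtrace (Pow {..<N}) \<rho> = 1" and psd: "pos_semidef (Pow {..<N}) \<rho>"
    using \<rho> by (simp_all add: mixed_state_def)
  from pos_semidef_imp_gram [OF _ psd] obtain w
    where "\<forall>x\<in>Pow {..<N}. \<forall>y\<in>Pow {..<N}. \<rho> x y = (\<Sum>i\<in>Pow {..<N}. w i x * cnj (w i y))" by auto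
  then have ens: "ensemble {..<N} \<rho> (Pow {..<N}) w"
    unfolding ensemble_def by blast
  have nonneg: "0 \<le> conc_A N \<rho> Y" if "Y \<subseteq> {1..<N}" for Y
  proof -
    have "finite Y" "0 \<notin> Y" "insert 0 Y \<subseteq> {..<N}"
      using that \<open>2 \<le> N\<close> finite_subset by auto
    then show ?thesis
      unfolding conc_A_def using tr
      by (intro concurrence_nonneg [OF _ _ _ ensemble_reduced [OF _ _ ens]]) (simp_all add: mtrace_reduced)
  qed
  show "0 \<le> conc_A_from N \<rho> i"
    unfolding conc_A_from_def using i by (intro nonneg) auto
  show "0 \<le> conc_AB N \<rho> i" if "i < N"
    unfolding conc_AB_def using i that by (intro nonneg) auto
  show "(conc_AB N \<rho> i)\<^sup>2 + (conc_A_from N \<rho> (i + 1))\<^sup>2 \<le> (conc_A_from N \<rho> i)\<^sup>2" if "i < N"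
  proof -
    \<comment> \<open>Monogamy is applied to the reduced state on A and the qubits from
      \<open>i\<close> on, with \<open>i\<close> split off; successive partial traces
      compose.\<close>
    define S where "S = insert 0 (insert i {i + 1..<N})"
    have S: "S = insert 0 {i..<N}" using that by (auto simp: S_def)
    have sub: "S \<subseteq> {..<N}" "{0, i} \<subseteq> S" "insert 0 {i + 1..<N} \<subseteq> S"
      using that by (auto simp: S_def)
    have "(concurrence {0, i} {0} (reduced S {0, i} (reduced {..<N} S \<rho>)))\<^sup>2 +
      (concurrence (insert 0 {i + 1..<N}) {0} (reduced S (insert 0 {i + 1..<N}) (reduced {..<N} S \<rho>)))\<^sup>2
      \<le> (concurrence S {0} (reduced {..<N} S \<rho>))\<^sup>2"
      unfolding S_def
    proof (rule concurrence_monogamy)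
      show "ensemble (insert 0 (insert i {i + 1..<N})) (reduced {..<N} (insert 0 (insert i {i + 1..<N})) \<rho>)
        (Pow {..<N} \<times> Pow ({..<N} - S)) (\<lambda>q x. w (fst q) (x \<union> snd q))"
        using ensemble_reduced [OF _ sub(1) ens] by (simp add: S_def)
      show "mtrace (Pow (insert 0 (insert i {i + 1..<N}))) (reduced {..<N} (insert 0 (insert i {i + 1..<N})) \<rho>) = 1"
        using mtrace_reduced [OF _ sub(1), of \<rho>] tr by (simp add: S_def)
    qed (use i in auto)
    then show ?thesis
      unfolding conc_AB_def conc_A_from_def conc_A_def
      using reduced_reduced [OF _ sub(2,1), of \<rho>] reduced_reduced [OF _ sub(3,1), of \<rho>] S by simp
  qed
qed

theorem theorem2:
  fixes k \<beta> :: real and N :: nat and \<rho> :: "nat set \<Rightarrow> nat set \<Rightarrow> complex"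
  assumes "0 < k" and "k \<le> 1"
    and "2 \<le> N"
    and "mixed_state {..<N} \<rho>"
    and "\<forall>i\<in>{1..N - 2}. k * (conc_AB N \<rho> i)\<^sup>2 \<ge> (conc_A_from N \<rho> (i + 1))\<^sup>2"
    and "4 \<le> \<beta>"
  shows "conc_A_from N \<rho> 1 powr \<beta>
    \<ge> (\<Sum>i = 1..N - 2. (\<Prod>j = 1..i. M_coeff k \<beta> N \<rho> j) * conc_AB N \<rho> (i + 1) powr \<beta>)"
proof -
  note mono = conc_A_monogamy [OF assms(3,4)]
  define c where "c i = conc_AB N \<rho> i powr \<beta>" for i
  define d where "d i = conc_A_from N \<rho> i powr \<beta>" for i
  have step: "c i + M_coeff k \<beta> N \<rho> i * d (Suc i) \<le> d i \<and> 0 \<le> M_coeff k \<beta> N \<rho> i"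
    if "1 \<le> i" "i < N - 1" for i
    unfolding c_def d_def M_coeff_def
    using monogamy_power_step [of k \<beta> "conc_AB N \<rho> i" "conc_A_from N \<rho> (i + 1)" "conc_A_from N \<rho> i"]
      mono [of i] mono(1) [of "i + 1"] that assms(1,2,5,6) by simp
  \<comment> \<open>At the end of the chain a single qubit remains, so both kinds of concurrence
    coincide.\<close>
  have "{N - 1..<N} = {N - 1}" using assms(3) by auto
  then have "c (N - 1) \<le> d (N - 1)"
    by (simp add: c_def d_def conc_AB_def conc_A_from_def)
  then have chain: "c 1 + (\<Sum>i = 1..N - 1 - 1. (\<Prod>j = 1..i. M_coeff k \<beta> N \<rho> j) * c (i + 1)) \<le> d 1"
    using step assms(3) by (intro monogamy_chain) auto
  have N: "N - 1 - 1 = N - 2" by simp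
  \<comment> \<open>The chain yields the extra nonnegative summand \<open>c 1\<close>, which the
    stated bound drops.\<close>
  have "0 \<le> c 1" by (simp add: c_def)
  with chain [unfolded N] have "(\<Sum>i = 1..N - 2. (\<Prod>j = 1..i. M_coeff k \<beta> N \<rho> j) * c (i + 1)) \<le> d 1"
    by linarith
  then show ?thesis by (simp only: c_def d_def)
qed

end
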